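(* Let $\mathcal C$ be a $(G,\mu)$-graded-monoidal category with $\mu$ symmetric, and let $\mathbb A_1,\mathbb A_2,\mathbb B_1,\mathbb B_2$ be homogeneous polycomplexes in $\mathcal C$. Then $$\mathbb A_1\simeq\mathbb B_1\ \text{ and }\ \mathbb A_2\simeq\mathbb B_2\quad\text{implies}\quad\mathbb A_1\otimes\mathbb A_2\simeq\mathbb B_1\otimes\mathbb B_2,$$ where $\simeq$ denotes homotopy equivalence (in the usual sense) of the associated total complexes and $\otimes$ is the graded tensor product of homogeneous polycomplexes.
   Context: $G$ is an abelian group, $\Bbbk$ a commutative ring, $\mu\colon G\times G\to\Bbbk^\times$ a $\mathbb Z$-bilinear map; $\mu$ is symmetric if $\mu(g,h)\mu(h,g)=1$ for all $g,h$. **Graded-monoidal category.** A $(G,\mu)$-graded-monoidal category $\mathcal C$ is a category whose Hom-sets are $G$-graded $\Bbbk$-modules with bilinear, degree-additive composition, together with a unit object and a strictly associative and unital tensor product on objects and (bilinear, degree-additive) on morphisms, preserving identities and satisfying, for homogeneous morphisms, $(f\otimes g)\circ(h\otimes k)=\mu(\deg g,\deg h)(f\circ h)\otimes(g\circ k)$. **Homogeneous polycomplexes.** View $\mathbb Z^n$ as a graph with edges $r\to r+e_i$ ($e_1,\dots,e_n$ the canonical basis). A homogeneous $n$-polycomplex $\mathbb A=(A,\alpha,\psi_{\mathbb A})$ consists of objects $A^r$ ($r\in\mathbb Z^n$); homogeneous morphisms $\alpha_i^r\colon A^r\to A^{r+e_i}$ ($1\le i\le n$) with $\alpha_i^{r+e_i}\circ\alpha_i^r=0$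 and $\alpha_j^{r+e_i}\circ\alpha_i^r=-\alpha_i^{r+e_j}\circ\alpha_j^r$ for $i\neq j$; and a $G$-valued 1-cocycle $\psi_{\mathbb A}$ on the graph $\mathbb Z^n$ (a function on edges, vanishing on all cycles) with $\psi_{\mathbb A}(r\to r+e_i)=\deg\alpha_i^r$ whenever $\alpha_i^r\ne0$. Its total complex is $\mathrm{Tot}(\mathbb A)_t=\bigoplus_{|r|=t}A^r$, where $|r|=r_1+\dots+r_n$, with differential $\sum_i\alpha_i^r$ on $A^r$ (direct sums being taken in the additive closure and assumed available). Chain maps and homotopies between homogeneous polycomplexes are the usual ones between total complexes (no grading condition). $|\alpha|(r)\in G$ denotes the value of $\psi_{\mathbb A}$ on any path from $0$ to $r$. A homogeneous polycomplex is a homogeneous $n$-polycomplex for some $n$. **Tensor product.** For a homogeneous $n$-polycomplex $\mathbb A=(A,\alpha,\psi_{\mathbb A})$ and a homogeneous $m$-polycomplex $\mathbb B=(B,\beta,\psi_{\mathbb B})$, $\mathbb A\otimes\mathbb B$ is the homogeneous $(n+m)$-polycomplex with objects $A^r\otimes B^s$ at $(r,s)\in\mathbb Z^{n+m}$, morphisms $\alpha_i^r\otimes\mathrm{id}_{B^s}$ in the first $n$ directions and $$(-1)^{|r|}\,\mu\big(|\alpha|(r),\psi_{\mathbb B}(s\to s+e_j)\big)\ \mathrm{id}_{A^r}\otimes\beta_j^s$$ in the last $m$ directions, and 1-cocycle equal to $\psi_{\mathbb A}$ (resp. $\psi_{\mathbb B}$) in the first $n$ (resp. last $m$) directions. *)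

theory Defs
  imports Main
begin

text \<open>
  The sort \<open>{comm_ring, comm_monoid_mult}\<close> is that of commutative unital rings; in contrast to
  \<open>comm_ring_1\<close> it does not exclude the zero ring.
\<close>

definition bicharacter ::
    "('g::ab_group_add \<Rightarrow> 'g \<Rightarrow> 'k::{comm_ring, comm_monoid_mult}) \<Rightarrow> bool" where
  "bicharacter \<mu> \<longleftrightarrow>
     (\<forall>g h. \<mu> g h dvd 1) \<and>
     (\<forall>g g' h. \<mu> (g + g') h = \<mu> g h * \<mu> g' h) \<and>
     (\<forall>g h h'. \<mu> g (h + h') = \<mu> g h * \<mu> g h')"

definition symmetric_bicharacter ::
    "('g::ab_group_add \<Rightarrow> 'g \<Rightarrow> 'k::{comm_ring, comm_monoid_mult}) \<Rightarrow> bool" where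
  "symmetric_bicharacter \<mu> \<longleftrightarrow> bicharacter \<mu> \<and> (\<forall>g h. \<mu> g h * \<mu> h g = 1)"


section \<open>Graded modules\<close>

text \<open>
  Modules are carried by subsets \<open>M\<close> of an ambient abelian group; the module laws are required
  on \<open>M\<close> only.
\<close>

definition module_on ::
    "('k::{comm_ring, comm_monoid_mult} \<Rightarrow> 'm \<Rightarrow> 'm) \<Rightarrow> 'm::ab_group_add set \<Rightarrow> bool" where
  "module_on s M \<longleftrightarrow>
     0 \<in> M \<and> (\<forall>x\<in>M. \<forall>y\<in>M. x + y \<in> M) \<and> (\<forall>a. \<forall>x\<in>M. s a x \<in> M) \<and>
     (\<forall>a. \<forall>x\<in>M. \<forall>y\<in>M. s a (x + y) = s a x + s a y) \<and>
     (\<forall>a b. \<forall>x\<in>M. s (a + b) x = s a x + s b x) \<and>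
     (\<forall>a b. \<forall>x\<in>M. s a (s b x) = s (a * b) x) \<and>
     (\<forall>x\<in>M. s 1 x = x)"

text \<open>\<open>M\<close> is the internal direct sum of its submodules \<open>D g\<close>, for \<open>g\<close> in the grading group.\<close>

definition graded_module_on ::
    "('k::{comm_ring, comm_monoid_mult} \<Rightarrow> 'm \<Rightarrow> 'm) \<Rightarrow> 'm::ab_group_add set \<Rightarrow> ('g \<Rightarrow> 'm set) \<Rightarrow> bool"
  where
  "graded_module_on s M D \<longleftrightarrow>
     module_on s M \<and> (\<forall>g. D g \<subseteq> M \<and> module_on s (D g)) \<and>
     (\<forall>x\<in>M. \<exists>S c. finite S \<and> (\<forall>g\<in>S. c g \<in> D g) \<and> x = (\<Sum>g\<in>S. c g)) \<and>
     (\<forall>S c. finite S \<and> (\<forall>g\<in>S. c g \<in> D g) \<and> (\<Sum>g\<in>S. c g) = 0 \<longrightarrow> (\<forall>g\<in>S. c g = 0))"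


section \<open>Graded-monoidal categories\<close>

text \<open>
  The objects are the elements of \<open>'o\<close>. All Hom-modules live in one ambient abelian group \<open>'m\<close>,
  which is no restriction: one may take for \<open>'m\<close> the direct sum of all Hom-modules. Only
  the common zero of that sum then belongs to several Hom-modules, so composition and tensor product
  need not mention source and target objects. Their values outside of the relevant Hom-modules are
  irrelevant.
\<close>

record ('k, 'g, 'o, 'm) gmcat =
  Hom   :: "'o \<Rightarrow> 'o \<Rightarrow> 'm set"
  HomD  :: "'o \<Rightarrow> 'o \<Rightarrow> 'g \<Rightarrow> 'm set"
  scale :: "'k \<Rightarrow> 'm \<Rightarrow> 'm"
  cmp   :: "'m \<Rightarrow> 'm \<Rightarrow> 'm"  (infixl "\<cdot>\<index>" 70)
  idm   :: "'o \<Rightarrow> 'm"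
  unit  :: "'o"
  tobj  :: "'o \<Rightarrow> 'o \<Rightarrow> 'o"  (infixl "\<odot>\<index>" 75)
  tmor  :: "'m \<Rightarrow> 'm \<Rightarrow> 'm"  (infixl "\<otimes>\<index>" 75)

locale graded_monoidal_category =
  fixes \<mu> :: "'g::ab_group_add \<Rightarrow> 'g \<Rightarrow> 'k::{comm_ring, comm_monoid_mult}"
    and C :: "('k, 'g, 'o, 'm::ab_group_add) gmcat" (structure)
  assumes bichar: "bicharacter \<mu>"
    and Hom_graded: "graded_module_on (scale C) (Hom C a b) (HomD C a b)"
    and cmp_in: "f \<in> Hom C a b \<Longrightarrow> g \<in> Hom C b c \<Longrightarrow> g \<cdot> f \<in> Hom C a c"
    and id_in: "idm C a \<in> Hom C a a"
    and cmp_assoc: "f \<in> Hom C a b \<Longrightarrow> g \<in> Hom C b c \<Longrightarrow> h \<in> Hom C c d \<Longrightarrow>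
          (h \<cdot> g) \<cdot> f = h \<cdot> (g \<cdot> f)"
    and cmp_id: "f \<in> Hom C a b \<Longrightarrow> f \<cdot> idm C a = f"
    and id_cmp: "f \<in> Hom C a b \<Longrightarrow> idm C b \<cdot> f = f"
    and cmp_add_right: "f \<in> Hom C a b \<Longrightarrow> f' \<in> Hom C a b \<Longrightarrow> g \<in> Hom C b c \<Longrightarrow>
          g \<cdot> (f + f') = g \<cdot> f + g \<cdot> f'"
    and cmp_add_left: "f \<in> Hom C a b \<Longrightarrow> g \<in> Hom C b c \<Longrightarrow> g' \<in> Hom C b c \<Longrightarrow>
          (g + g') \<cdot> f = g \<cdot> f + g' \<cdot> f"
    and cmp_scale_right: "f \<in> Hom C a b \<Longrightarrow> g \<in> Hom C b c \<Longrightarrow>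
          g \<cdot> scale C x f = scale C x (g \<cdot> f)"
    and cmp_scale_left: "f \<in> Hom C a b \<Longrightarrow> g \<in> Hom C b c \<Longrightarrow>
          scale C x g \<cdot> f = scale C x (g \<cdot> f)"
    and cmp_deg: "f \<in> HomD C a b u \<Longrightarrow> g \<in> HomD C b c v \<Longrightarrow> g \<cdot> f \<in> HomD C a c (v + u)"
    and tobj_assoc: "(a \<odot> b) \<odot> c = a \<odot> (b \<odot> c)"
    and tobj_unit_left: "unit C \<odot> a = a"
    and tobj_unit_right: "a \<odot> unit C = a"
    and tmor_in: "f \<in> Hom C a b \<Longrightarrow> g \<in> Hom C c d \<Longrightarrow> f \<otimes> g \<in> Hom C (a \<odot> c) (b \<odot> d)"
    and tmor_add_left: "f \<in> Hom C a b \<Longrightarrow> f' \<in> Hom C a b \<Longrightarrow> g \<in> Hom C c d \<Longrightarrow>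
          (f + f') \<otimes> g = f \<otimes> g + f' \<otimes> g"
    and tmor_add_right: "f \<in> Hom C a b \<Longrightarrow> g \<in> Hom C c d \<Longrightarrow> g' \<in> Hom C c d \<Longrightarrow>
          f \<otimes> (g + g') = f \<otimes> g + f \<otimes> g'"
    and tmor_scale_left: "f \<in> Hom C a b \<Longrightarrow> g \<in> Hom C c d \<Longrightarrow>
          scale C x f \<otimes> g = scale C x (f \<otimes> g)"
    and tmor_scale_right: "f \<in> Hom C a b \<Longrightarrow> g \<in> Hom C c d \<Longrightarrow>
          f \<otimes> scale C x g = scale C x (f \<otimes> g)"
    and tmor_deg: "f \<in> HomD C a b u \<Longrightarrow> g \<in> HomD C c d v \<Longrightarrow>
          f \<otimes> g \<in> HomD C (a \<odot> c) (b \<odot> d) (u + v)"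
    and tmor_assoc: "f \<in> Hom C a a' \<Longrightarrow> g \<in> Hom C b b' \<Longrightarrow> h \<in> Hom C c c' \<Longrightarrow>
          (f \<otimes> g) \<otimes> h = f \<otimes> (g \<otimes> h)"
    and tmor_unit_left: "f \<in> Hom C a b \<Longrightarrow> idm C (unit C) \<otimes> f = f"
    and tmor_unit_right: "f \<in> Hom C a b \<Longrightarrow> f \<otimes> idm C (unit C) = f"
    and tmor_id: "idm C a \<otimes> idm C b = idm C (a \<odot> b)"
    \<comment> \<open>graded interchange law; \<open>u, v, w, z\<close> are the degrees of \<open>f, g, h, k\<close>\<close>
    and interchange: "h \<in> HomD C a b w \<Longrightarrow> f \<in> HomD C b c u \<Longrightarrow>
          k \<in> HomD C a' b' z \<Longrightarrow> g \<in> HomD C b' c' v \<Longrightarrow>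
          (f \<otimes> g) \<cdot> (h \<otimes> k) = scale C (\<mu> v w) ((f \<cdot> h) \<otimes> (g \<cdot> k))"


section \<open>Formal direct sums, complexes and homotopy equivalence\<close>

text \<open>
  A formal direct sum \<open>(I, X)\<close> stands for the direct sum of the objects \<open>X i\<close>, \<open>i \<in> I\<close>, in the
  additive closure. Total complexes may need infinite direct sums, so \<open>I\<close> may be infinite. A morphism
  \<open>(I, X) \<rightarrow> (J, Y)\<close> is a matrix whose entry \<open>F j i\<close> is a morphism \<open>X i \<rightarrow> Y j\<close> and each of whose
  columns has only finitely many nonzero entries. For finite sums the finiteness condition is void.
  Matrices are extended by zero outside of \<open>J \<times> I\<close>, so that equality of morphisms is equality of
  functions.
\<close>

type_synonym ('i, 'o) formal_sum = "'i set \<times> ('i \<Rightarrow> 'o)"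

definition sum_hom ::
    "('k, 'g, 'o, 'm::ab_group_add) gmcat \<Rightarrow> ('i, 'o) formal_sum \<Rightarrow> ('j, 'o) formal_sum \<Rightarrow>
     ('j \<Rightarrow> 'i \<Rightarrow> 'm) set" where
  "sum_hom C X Y =
     {F. (\<forall>i\<in>fst X. \<forall>j\<in>fst Y. F j i \<in> Hom C (snd X i) (snd Y j)) \<and>
         (\<forall>i j. i \<notin> fst X \<or> j \<notin> fst Y \<longrightarrow> F j i = 0) \<and>
         (\<forall>i\<in>fst X. finite {j. F j i \<noteq> 0})}"

definition sum_cmp ::
    "('k, 'g, 'o, 'm::ab_group_add) gmcat \<Rightarrow> ('l \<Rightarrow> 'j \<Rightarrow> 'm) \<Rightarrow> ('j \<Rightarrow> 'i \<Rightarrow> 'm) \<Rightarrow>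
     'l \<Rightarrow> 'i \<Rightarrow> 'm" where
  "sum_cmp C G F = (\<lambda>l i. \<Sum>j | F j i \<noteq> 0. G l j \<cdot>\<^bsub>C\<^esub> F j i)"

definition sum_id ::
    "('k, 'g, 'o, 'm::ab_group_add) gmcat \<Rightarrow> ('i, 'o) formal_sum \<Rightarrow> 'i \<Rightarrow> 'i \<Rightarrow> 'm" where
  "sum_id C X = (\<lambda>j i. if i \<in> fst X \<and> j = i then idm C (snd X i) else 0)"

record ('i, 'o, 'm) complex =
  cobj  :: "int \<Rightarrow> ('i, 'o) formal_sum"
  cdiff :: "int \<Rightarrow> 'i \<Rightarrow> 'i \<Rightarrow> 'm"

definition is_complex ::
    "('k, 'g, 'o, 'm::ab_group_add) gmcat \<Rightarrow> ('i, 'o, 'm) complex \<Rightarrow> bool" where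
  "is_complex C X \<longleftrightarrow>
     (\<forall>t. cdiff X t \<in> sum_hom C (cobj X t) (cobj X (t + 1)) \<and>
          sum_cmp C (cdiff X (t + 1)) (cdiff X t) = (\<lambda>j i. 0))"

definition chain_map ::
    "('k, 'g, 'o, 'm::ab_group_add) gmcat \<Rightarrow> ('i, 'o, 'm) complex \<Rightarrow> ('j, 'o, 'm) complex \<Rightarrow>
     (int \<Rightarrow> 'j \<Rightarrow> 'i \<Rightarrow> 'm) \<Rightarrow> bool" where
  "chain_map C X Y f \<longleftrightarrow>
     (\<forall>t. f t \<in> sum_hom C (cobj X t) (cobj Y t) \<and>
          sum_cmp C (cdiff Y t) (f t) = sum_cmp C (f (t + 1)) (cdiff X t))"

definition homotopic ::
    "('k, 'g, 'o, 'm::ab_group_add) gmcat \<Rightarrow> ('i, 'o, 'm) complex \<Rightarrow> ('j, 'o, 'm) complex \<Rightarrow>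
     (int \<Rightarrow> 'j \<Rightarrow> 'i \<Rightarrow> 'm) \<Rightarrow> (int \<Rightarrow> 'j \<Rightarrow> 'i \<Rightarrow> 'm) \<Rightarrow> bool" where
  "homotopic C X Y f g \<longleftrightarrow>
     (\<exists>h. (\<forall>t. h t \<in> sum_hom C (cobj X t) (cobj Y (t - 1))) \<and>
          (\<forall>t j i. f t j i - g t j i =
             sum_cmp C (cdiff Y (t - 1)) (h t) j i + sum_cmp C (h (t + 1)) (cdiff X t) j i))"

definition homotopy_equivalent ::
    "('k, 'g, 'o, 'm::ab_group_add) gmcat \<Rightarrow> ('i, 'o, 'm) complex \<Rightarrow> ('j, 'o, 'm) complex \<Rightarrow> bool"
  where
  "homotopy_equivalent C X Y \<longleftrightarrow>
     is_complex C X \<and> is_complex C Y \<and>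
     (\<exists>f g. chain_map C X Y f \<and> chain_map C Y X g \<and>
        homotopic C X X (\<lambda>t. sum_cmp C (g t) (f t)) (\<lambda>t. sum_id C (cobj X t)) \<and>
        homotopic C Y Y (\<lambda>t. sum_cmp C (f t) (g t)) (\<lambda>t. sum_id C (cobj Y t)))"


section \<open>Homogeneous polycomplexes\<close>

text \<open>
  A point of the lattice of rank \<open>n\<close> is an integer list of length \<open>n\<close>, and the directions are
  \<open>0, \<dots>, n - 1\<close>.
\<close>

definition lattice :: "nat \<Rightarrow> int list set" where
  "lattice n = {r. length r = n}"

definition shift :: "nat \<Rightarrow> int list \<Rightarrow> int list" where
  "shift i r = r[i := r ! i + 1]"

text \<open>
  \<open>path_value n \<psi> r s g\<close>: some path from \<open>r\<close> to \<open>s\<close> in the lattice graph has \<open>\<psi>\<close>-value \<open>g\<close>. Here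
  \<open>\<psi> i r\<close> is the value on the edge from \<open>r\<close> to \<open>shift i r\<close>; edges may be traversed in either
  direction, contributing \<open>- \<psi> i r\<close> when traversed backwards.
\<close>

inductive path_value ::
    "nat \<Rightarrow> (nat \<Rightarrow> int list \<Rightarrow> 'g::ab_group_add) \<Rightarrow> int list \<Rightarrow> int list \<Rightarrow> 'g \<Rightarrow> bool"
  for n \<psi> where
  empty: "r \<in> lattice n \<Longrightarrow> path_value n \<psi> r r 0"
| forward: "path_value n \<psi> r s g \<Longrightarrow> i < n \<Longrightarrow> path_value n \<psi> r (shift i s) (g + \<psi> i s)"
| backward: "path_value n \<psi> r (shift i s) g \<Longrightarrow> i < n \<Longrightarrow> s \<in> lattice n \<Longrightarrow>
    path_value n \<psi> r s (g - \<psi> i s)"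

definition cocycle :: "nat \<Rightarrow> (nat \<Rightarrow> int list \<Rightarrow> 'g::ab_group_add) \<Rightarrow> bool" where
  "cocycle n \<psi> \<longleftrightarrow> (\<forall>r g. path_value n \<psi> r r g \<longrightarrow> g = 0)"

record ('g, 'o, 'm) polycomplex =
  pdim  :: nat
  pobj  :: "int list \<Rightarrow> 'o"
  pdiff :: "nat \<Rightarrow> int list \<Rightarrow> 'm"
  pcoc  :: "nat \<Rightarrow> int list \<Rightarrow> 'g"

text \<open>
  As zero lies in every graded piece, the condition \<open>pdiff A i r \<in> HomD C _ _ (pcoc A i r)\<close>
  says that \<open>pdiff A i r\<close> is homogeneous, and of degree \<open>pcoc A i r\<close> if it is nonzero.
\<close>

definition homogeneous_polycomplex ::
    "('k, 'g::ab_group_add, 'o, 'm::ab_group_add) gmcat \<Rightarrow> ('g, 'o, 'm) polycomplex \<Rightarrow> bool" where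
  "homogeneous_polycomplex C A \<longleftrightarrow>
     cocycle (pdim A) (pcoc A) \<and>
     (\<forall>r\<in>lattice (pdim A). \<forall>i<pdim A.
        pdiff A i r \<in> HomD C (pobj A r) (pobj A (shift i r)) (pcoc A i r) \<and>
        pdiff A i (shift i r) \<cdot>\<^bsub>C\<^esub> pdiff A i r = 0 \<and>
        (\<forall>j<pdim A. i \<noteq> j \<longrightarrow>
           pdiff A j (shift i r) \<cdot>\<^bsub>C\<^esub> pdiff A i r = - (pdiff A i (shift j r) \<cdot>\<^bsub>C\<^esub> pdiff A j r)))"

definition Tot :: "('g, 'o, 'm::ab_group_add) polycomplex \<Rightarrow> (int list, 'o, 'm) complex" where
  "Tot A =
     \<lparr>cobj = (\<lambda>t. ({r \<in> lattice (pdim A). sum_list r = t}, pobj A)),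
      cdiff = (\<lambda>t s r. if r \<in> lattice (pdim A) \<and> sum_list r = t
                 then \<Sum>i | i < pdim A \<and> s = shift i r. pdiff A i r else 0)\<rparr>"

text \<open>The value of the cocycle on any path from the origin to \<open>r\<close>.\<close>

definition total_deg :: "('g::ab_group_add, 'o, 'm) polycomplex \<Rightarrow> int list \<Rightarrow> 'g" where
  "total_deg A r = (THE g. path_value (pdim A) (pcoc A) (replicate (pdim A) 0) r g)"

definition koszul_sign :: "int \<Rightarrow> 'k::{comm_ring, comm_monoid_mult}" where
  "koszul_sign t = (if even t then 1 else - 1)"

text \<open>A point of the lattice of rank \<open>n + m\<close> is split into its first \<open>n\<close> and last \<open>m\<close> coordinates.\<close>

definition tensor ::
    "('g \<Rightarrow> 'g \<Rightarrow> 'k::{comm_ring, comm_monoid_mult}) \<Rightarrow> ('k, 'g::ab_group_add, 'o, 'm::ab_group_add) gmcat \<Rightarrow>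
     ('g, 'o, 'm) polycomplex \<Rightarrow> ('g, 'o, 'm) polycomplex \<Rightarrow> ('g, 'o, 'm) polycomplex" where
  "tensor \<mu> C A B =
     (let n = pdim A in
      \<lparr>pdim = n + pdim B,
       pobj = (\<lambda>p. pobj A (take n p) \<odot>\<^bsub>C\<^esub> pobj B (drop n p)),
       pdiff = (\<lambda>i p. let r = take n p; s = drop n p in
          if i < n then pdiff A i r \<otimes>\<^bsub>C\<^esub> idm C (pobj B s)
          else scale C (koszul_sign (sum_list r) * \<mu> (total_deg A r) (pcoc B (i - n) s))
                 (idm C (pobj A r) \<otimes>\<^bsub>C\<^esub> pdiff B (i - n) s)),
       pcoc = (\<lambda>i p. if i < n then pcoc A i (take n p) else pcoc B (i - n) (drop n p))\<rparr>)"

end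

theory Submission
  imports Defs "HOL-Library.Function_Algebras"
begin

text \<open>
  The degree of a morphism \<open>A\<^sup>r \<rightarrow> B\<^sup>s\<close> is normalized by adding \<open>|\<alpha>|(r) - |\<beta>|(s)\<close>; differentials
  then have normalized degree zero. A homogeneous \<open>f\<close> of normalized degree \<open>u\<close> is sent to
  \<open>\<mu>(|\<gamma>|(q), u) f \<otimes> id\<close> on \<open>A\<^sup>r \<otimes> K\<^sup>q\<close>, where \<open>|\<gamma>|\<close> belongs to \<open>K\<close>, and a homogeneous \<open>h\<close> to
  \<open>\<mu>(|\<alpha>|(r), deg h) id \<otimes> h\<close>, with a Koszul sign. Extended linearly to arbitrary morphisms, both assignments are functors on
  matrices, the differential of the tensor product is the sum of the images of the two
  differentials, and the images of a degree \<open>u\<close> and a degree \<open>v\<close> map commute up to Koszul sign and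
  \<open>\<mu>(v, u)\<close>, in particular whenever one of the two normalized degrees vanishes. Hence tensoring with
  a fixed polycomplex on either side preserves homotopy equivalences, although the maps
  involved need not be homogeneous.
\<close>

section \<open>Homogeneous components\<close>

text \<open>The obstacle is that \<open>f \<otimes> id\<close> need not be a chain map when
  \<open>f\<close> is an inhomogeneous chain map. Moving \<open>id \<otimes> h\<close> past a
  component of \<open>f\<close> costs \<mu>(deg h, deg f), which varies with the component, and the
  coefficient \<mu>(|\<alpha>|(r), deg h) in the tensor differential becomes \<mu>(|\<beta>|(s), deg
  h) at the target. By symmetry these two discrepancies combine into \<mu>(deg h, u), where u is
  exactly the normalized degree of the component. The factor \<mu>(|\<gamma>|(q), u) absorbs it,
  because |\<gamma>|(q) grows by deg h when h is a differential. This dictates both the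
  normalization and the twist. Transitivity of homotopy equivalence joins the halves.

  Correction: the IDEA above contains a stray malformed symbol. The list below replaces it and is
  complete.\<close>

lemma koszul_sign_add: "(koszul_sign (s + t) :: 'k::{comm_ring, comm_monoid_mult}) = koszul_sign s * koszul_sign t"
proof -
  have "(- 1) * (- 1) = (1::'k)" "1 * x = x" "x * 1 = x" for x :: 'k
    by (simp_all only: minus_mult_minus mult_1_left mult_1_right)
  then show ?thesis by (simp add: koszul_sign_def)
qed

lemma koszul_sign_0 [simp]: "koszul_sign 0 = 1"
  by (simp add: koszul_sign_def)

text \<open>Additivity makes the value at zero idempotent, and it is a unit by definition; the only
  idempotent unit is \<open>1\<close>.\<close>

lemma bicharacter_zero:
  assumes "bicharacter \<mu>"
  shows "\<mu> 0 h = 1" "\<mu> g 0 = 1"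
proof -
  have *: "a = 1" if "a * a = a" "a dvd 1" for a :: 'b
    using that by (metis dvd_def mult.assoc mult.right_neutral)
  show "\<mu> 0 h = 1"
    using assms unfolding bicharacter_def by (intro *) (metis add_0, blast)
  show "\<mu> g 0 = 1"
    using assms unfolding bicharacter_def by (intro *) (metis add_0, blast)
qed

lemma sum_support: "finite S \<Longrightarrow> {d. c d \<noteq> 0} \<subseteq> S \<Longrightarrow> (\<Sum>d\<in>S. c d) = (\<Sum>d | c d \<noteq> 0. c d)"
  for c :: "'x \<Rightarrow> 'y::comm_monoid_add"
  by (rule sum.mono_neutral_right) auto

context graded_monoidal_category
begin

section \<open>Module laws and bilinearity\<close>

lemma mu_add_left: "\<mu> (g + g') h = \<mu> g h * \<mu> g' h"
  and mu_add_right: "\<mu> g (h + h') = \<mu> g h * \<mu> g h'"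
  using bichar by (auto simp: bicharacter_def)

lemmas mu_zero [simp] = bicharacter_zero[OF bichar]

lemma Hom_module: "module_on (scale C) (Hom C a b)"
  and HomD_module: "module_on (scale C) (HomD C a b d)"
  and HomD_subset: "HomD C a b d \<subseteq> Hom C a b"
  using Hom_graded unfolding graded_module_on_def by blast+

lemma Hom_decomposition:
  "f \<in> Hom C a b \<Longrightarrow> \<exists>S c. finite S \<and> (\<forall>d\<in>S. c d \<in> HomD C a b d) \<and> f = (\<Sum>d\<in>S. c d)"
  using Hom_graded unfolding graded_module_on_def by blast

lemma HomD_independent:
  "finite S \<Longrightarrow> \<forall>d\<in>S. c d \<in> HomD C a b d \<Longrightarrow> (\<Sum>d\<in>S. c d) = 0 \<Longrightarrow> \<forall>d\<in>S. c d = 0"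
  using Hom_graded unfolding graded_module_on_def by blast

lemma HomD_Hom: "f \<in> HomD C a b d \<Longrightarrow> f \<in> Hom C a b"
  using HomD_subset by blast

lemma zero_Hom [simp]: "0 \<in> Hom C a b"
  and add_Hom [simp]: "f \<in> Hom C a b \<Longrightarrow> f' \<in> Hom C a b \<Longrightarrow> f + f' \<in> Hom C a b"
  and scale_Hom [simp]: "f \<in> Hom C a b \<Longrightarrow> scale C x f \<in> Hom C a b"
  and scale_add: "f \<in> Hom C a b \<Longrightarrow> f' \<in> Hom C a b \<Longrightarrow> scale C x (f + f') = scale C x f + scale C x f'"
  and scale_add_left: "f \<in> Hom C a b \<Longrightarrow> scale C (x + y) f = scale C x f + scale C y f"
  and scale_scale: "f \<in> Hom C a b \<Longrightarrow> scale C x (scale C y f) = scale C (x * y) f"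
  and scale_one: "f \<in> Hom C a b \<Longrightarrow> scale C 1 f = f"
  using Hom_module[of a b] unfolding module_on_def by auto

lemma zero_HomD [simp]: "0 \<in> HomD C a b d"
  and add_HomD [simp]: "f \<in> HomD C a b d \<Longrightarrow> f' \<in> HomD C a b d \<Longrightarrow> f + f' \<in> HomD C a b d"
  and scale_HomD [simp]: "f \<in> HomD C a b d \<Longrightarrow> scale C x f \<in> HomD C a b d"
  using HomD_module[of a b d] unfolding module_on_def by auto

lemma scale_zero [simp]: "scale C x 0 = 0"
  \<comment> \<open>Zero lies in every Hom-module, so any pair of objects will do.\<close>
  using scale_add[of 0 undefined undefined 0 x] by simp

lemma scale_zero_left: "f \<in> Hom C a b \<Longrightarrow> scale C 0 f = 0"
  using scale_add_left[of f a b 0 0] by simp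

lemma scale_minus_one: "f \<in> Hom C a b \<Longrightarrow> scale C (- 1) f = - f"
  using scale_add_left[of f a b 1 "- 1"]
  by (simp add: scale_zero_left scale_one) (metis add_eq_0_iff)

lemma minus_HomD [simp]: "f \<in> HomD C a b d \<Longrightarrow> - f \<in> HomD C a b d"
  by (metis scale_HomD scale_minus_one HomD_Hom)

lemma sum_Hom: "(\<And>i. i \<in> S \<Longrightarrow> f i \<in> Hom C a b) \<Longrightarrow> sum f S \<in> Hom C a b"
  by (induction S rule: infinite_finite_induct) auto

lemma cmp_zero [simp]: "g \<in> Hom C b c \<Longrightarrow> g \<cdot> 0 = 0" "f \<in> Hom C a b \<Longrightarrow> 0 \<cdot> f = 0"
  using cmp_add_right[of 0 b b 0 g c] cmp_add_left[of f a b 0 b 0] by simp_all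

lemma tmor_zero [simp]: "g \<in> Hom C b c \<Longrightarrow> 0 \<otimes> g = 0" "f \<in> Hom C a b \<Longrightarrow> f \<otimes> 0 = 0"
  using tmor_add_left[of 0 b b 0 g b c] tmor_add_right[of f a b 0 b b 0] by simp_all

lemma cmp_sum_right:
  assumes "\<And>i. i \<in> S \<Longrightarrow> f i \<in> Hom C a b" "g \<in> Hom C b c"
  shows "g \<cdot> sum f S = (\<Sum>i\<in>S. g \<cdot> f i)"
  using assms by (induction S rule: infinite_finite_induct) (auto simp: cmp_add_right[of _ a b _ _ c] sum_Hom)

lemma cmp_sum_left:
  assumes "f \<in> Hom C a b" "\<And>i. i \<in> S \<Longrightarrow> g i \<in> Hom C b c"
  shows "sum g S \<cdot> f = (\<Sum>i\<in>S. g i \<cdot> f)"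
  using assms by (induction S rule: infinite_finite_induct) (auto simp: cmp_add_left[of _ a b _ c] sum_Hom)

text \<open>An identity additive in \<open>f\<close> has to be checked on homogeneous morphisms
  only. The interchange law is given just for these, and this rule carries its consequences to
  arbitrary morphisms.\<close>

lemma Hom_induct [consumes 1, case_names homogeneous add]:
  assumes "f \<in> Hom C a b"
    and homogeneous: "\<And>d f. f \<in> HomD C a b d \<Longrightarrow> P f"
    and add: "\<And>f f'. f \<in> Hom C a b \<Longrightarrow> f' \<in> Hom C a b \<Longrightarrow> P f \<Longrightarrow> P f' \<Longrightarrow> P (f + f')"
  shows "P f"
proof -
  obtain S c where S: "finite S" "\<forall>d\<in>S. c d \<in> HomD C a b d" and f: "f = (\<Sum>d\<in>S. c d)"
    using Hom_decomposition[OF assms(1)] by blast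
  have "P (\<Sum>d\<in>S. c d)" using S
  proof (induction S)
    case empty
    \<comment> \<open>The empty sum is zero, which is homogeneous of every degree; hence there is no
      separate zero case.\<close>
    show ?case using homogeneous[of 0] by simp
  next
    case (insert d S)
    have "sum c S \<in> Hom C a b" using insert.prems HomD_Hom by (blast intro: sum_Hom)
    moreover have "P (c d)" "c d \<in> Hom C a b" using insert.prems homogeneous HomD_Hom by blast+
    ultimately have "P (c d + sum c S)" using insert by (intro add) auto
    then show ?case using insert.hyps by simp
  qed
  then show ?thesis by (simp add: f)
qed

section \<open>Homogeneous components and twisting by a character\<close>

definition is_components :: "'o \<Rightarrow> 'o \<Rightarrow> 'm \<Rightarrow> ('g \<Rightarrow> 'm) \<Rightarrow> bool" where
  "is_components a b f c \<longleftrightarrow>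
     (\<forall>d. c d \<in> HomD C a b d) \<and> finite {d. c d \<noteq> 0} \<and> f = (\<Sum>d | c d \<noteq> 0. c d)"

lemma is_components_exists: "f \<in> Hom C a b \<Longrightarrow> \<exists>c. is_components a b f c"
proof -
  assume "f \<in> Hom C a b"
  then obtain S c where S: "finite S" "\<forall>d\<in>S. c d \<in> HomD C a b d" and f: "f = (\<Sum>d\<in>S. c d)"
    by (blast dest: Hom_decomposition)
  let ?c = "\<lambda>d. if d \<in> S then c d else 0"
  have "finite {d. ?c d \<noteq> 0}"
    by (rule finite_subset[OF _ S(1)]) auto
  moreover have "(\<Sum>d\<in>S. ?c d) = (\<Sum>d | ?c d \<noteq> 0. ?c d)"
    using S(1) by (rule sum_support) auto
  then have "f = (\<Sum>d | ?c d \<noteq> 0. ?c d)"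
    unfolding f by simp
  ultimately have "is_components a b f ?c"
    using S(2) by (simp add: is_components_def)
  then show ?thesis by (rule exI[where x = ?c])
qed

lemma is_components_add:
  assumes "is_components a b f c" "is_components a b f' c'"
  shows "is_components a b (f + f') (\<lambda>d. c d + c' d)"
proof -
  let ?S = "{d. c d \<noteq> 0} \<union> {d. c' d \<noteq> 0}"
  have fin: "finite ?S" using assms by (simp add: is_components_def)
  have sub: "{d. c d + c' d \<noteq> 0} \<subseteq> ?S" by auto
  have "f + f' = (\<Sum>d\<in>?S. c d) + (\<Sum>d\<in>?S. c' d)"
    using assms sum_support[OF fin, of c] sum_support[OF fin, of c'] by (simp add: is_components_def)
  also have "\<dots> = (\<Sum>d\<in>?S. c d + c' d)" by (simp add: sum.distrib)
  also have "\<dots> = (\<Sum>d | c d + c' d \<noteq> 0. c d + c' d)"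
    by (rule sum_support[OF fin sub])
  finally show ?thesis
    using assms finite_subset[OF sub fin] by (simp add: is_components_def)
qed

lemma is_components_minus:
  assumes "is_components a b f c" shows "is_components a b (- f) (\<lambda>d. - c d)"
  using assms by (simp add: is_components_def sum_negf)

text \<open>The difference of two families of components is such a family for zero, so it vanishes
  by independence. As families are finitely supported functions on the whole grading group, this is
  an equality of functions, and the choice in \<open>twist\<close> is determined.\<close>

lemma is_components_unique:
  assumes "is_components a b f c" "is_components a b f c'"
  shows "c = c'"
proof -
  have *: "is_components a b 0 (\<lambda>d. c d + - c' d)"
    using is_components_add[OF assms(1) is_components_minus[OF assms(2)]] by simp
  have "c d + - c' d = 0" for d
    using * HomD_independent[of "{d. c d + - c' d \<noteq> 0}" "\<lambda>d. c d + - c' d" a b]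
    unfolding is_components_def by auto
  then show ?thesis by (intro ext) simp
qed

text \<open>The gradings on different Hom-modules need not agree on common elements, whence the
  dependence on \<open>a\<close> and \<open>b\<close>.\<close>

definition twist :: "('g \<Rightarrow> 'k) \<Rightarrow> 'o \<Rightarrow> 'o \<Rightarrow> 'm \<Rightarrow> 'm" where
  "twist \<chi> a b f =
     (let c = (SOME c. is_components a b f c) in \<Sum>d | c d \<noteq> 0. scale C (\<chi> d) (c d))"

lemma twist_eq:
  assumes "is_components a b f c" "finite S" "{d. c d \<noteq> 0} \<subseteq> S"
  shows "twist \<chi> a b f = (\<Sum>d\<in>S. scale C (\<chi> d) (c d))"
proof -
  have "(SOME c. is_components a b f c) = c"
    using is_components_unique[OF _ assms(1)] assms(1) by blast
  then show ?thesis
    unfolding twist_def Let_def using assms(2,3) by (auto intro!: sum.mono_neutral_left)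
qed

lemma is_components_homogeneous:
  assumes "f \<in> HomD C a b d" shows "is_components a b f (\<lambda>e. if e = d then f else 0)"
proof -
  let ?c = "\<lambda>e. if e = d then f else 0"
  have sub: "{e. ?c e \<noteq> 0} \<subseteq> {d}" by auto
  then have "finite {e. ?c e \<noteq> 0}" by (rule finite_subset) simp
  moreover have "f = (\<Sum>e | ?c e \<noteq> 0. ?c e)"
    using sum_support[OF _ sub] by simp
  ultimately show ?thesis
    using assms by (simp add: is_components_def)
qed

lemma twist_homogeneous:
  assumes "f \<in> HomD C a b d" shows "twist \<chi> a b f = scale C (\<chi> d) f"
  using twist_eq[OF is_components_homogeneous[OF assms], of "{d}" \<chi>]
  by (simp add: Collect_conv_if)

lemma twist_add:
  assumes "f \<in> Hom C a b" "f' \<in> Hom C a b"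
  shows "twist \<chi> a b (f + f') = twist \<chi> a b f + twist \<chi> a b f'"
proof -
  obtain c c' where c: "is_components a b f c" and c': "is_components a b f' c'"
    using is_components_exists assms by blast
  let ?S = "{d. c d \<noteq> 0} \<union> {d. c' d \<noteq> 0}"
  have fin: "finite ?S" using c c' by (simp add: is_components_def)
  have mem: "c d \<in> Hom C a b" "c' d \<in> Hom C a b" for d
    using c c' by (auto simp: is_components_def intro: HomD_Hom)
  have "twist \<chi> a b (f + f') = (\<Sum>d\<in>?S. scale C (\<chi> d) (c d + c' d))"
    by (rule twist_eq[OF is_components_add[OF c c'] fin]) auto
  also have "\<dots> = (\<Sum>d\<in>?S. scale C (\<chi> d) (c d)) + (\<Sum>d\<in>?S. scale C (\<chi> d) (c' d))"
    by (simp add: scale_add[OF mem] sum.distrib)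
  also have "\<dots> = twist \<chi> a b f + twist \<chi> a b f'"
    by (simp add: twist_eq[OF c fin] twist_eq[OF c' fin])
  finally show ?thesis .
qed

lemma twist_zero [simp]: "twist \<chi> a b 0 = 0"
  using twist_homogeneous[of 0 a b 0 \<chi>] by simp

lemma twist_Hom [simp]: "f \<in> Hom C a b \<Longrightarrow> twist \<chi> a b f \<in> Hom C a b"
  by (induction rule: Hom_induct) (auto simp: twist_homogeneous twist_add dest: HomD_Hom)

text \<open>Degrees add under composition and \<chi> is multiplicative, so on homogeneous morphisms
  both sides carry the same scalar.\<close>

lemma twist_cmp:
  assumes "\<And>u v. \<chi> (u + v) = \<chi> u * \<chi> v" "f \<in> Hom C a b" "g \<in> Hom C b c"
  shows "twist \<chi> a c (g \<cdot> f) = twist \<chi> b c g \<cdot> twist \<chi> a b f"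
  using assms(2,3)
proof (induction f rule: Hom_induct)
  case (homogeneous u f)
  from homogeneous(2) show ?case
  proof (induction g rule: Hom_induct)
    case (homogeneous v g)
    have "f \<in> Hom C a b" "g \<in> Hom C b c" using homogeneous \<open>f \<in> HomD C a b u\<close> HomD_Hom by auto
    moreover have "g \<cdot> f \<in> HomD C a c (v + u)"
      using homogeneous \<open>f \<in> HomD C a b u\<close> cmp_deg by blast
    ultimately show ?case
      using homogeneous \<open>f \<in> HomD C a b u\<close>
      by (simp add: twist_homogeneous cmp_scale_left[of _ a b _ c] cmp_scale_right[of _ a b _ c]
          scale_scale[of _ a c] cmp_in[of _ a b _ c] assms(1) mult.commute)
  next
    case (add g g')
    then show ?case
      using HomD_Hom[OF \<open>f \<in> HomD C a b u\<close>]
      by (simp add: cmp_add_left[of _ a b _ c] twist_add cmp_in[of _ a b _ c])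
  qed
next
  case (add f f')
  then show ?case
    by (simp add: cmp_add_right[of _ a b _ _ c] twist_add cmp_in[of _ a b _ c])
qed

text \<open>If \<open>e\<close> is the degree zero component of the identity, then \<open>f \<cdot> e = f\<close> for every homogeneous
  \<open>f\<close>, by comparison of degrees; hence \<open>e\<close> is the identity.\<close>

lemma id_degree_zero: "idm C a \<in> HomD C a a 0"
proof -
  obtain c where c: "is_components a a (idm C a) c"
    using is_components_exists[OF id_in] by blast
  then have cD: "c d \<in> HomD C a a d" and fin: "finite {d. c d \<noteq> 0}"
    and ideq: "idm C a = (\<Sum>d | c d \<noteq> 0. c d)" for d
    by (auto simp: is_components_def)
  have cH: "c d \<in> Hom C a a" for d using cD HomD_Hom by blast
  have hom: "f \<cdot> c 0 = f" if f: "f \<in> HomD C a a u" for f u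
  proof -
    \<comment> \<open>Two component families for the same morphism: \<open>?p\<close> comes from
      expanding \<open>f \<cdot> idm C a\<close> and sorting by total degree, \<open>?q\<close> from
      \<open>f\<close> being homogeneous. Uniqueness is then read off at degree
      \<open>u\<close>.\<close>
    let ?p = "\<lambda>v. f \<cdot> c (v - u)" and ?q = "\<lambda>v. if v = u then f else 0"
    note fH = HomD_Hom[OF f]
    have D: "?p v \<in> HomD C a a v" for v
      using cmp_deg[OF cD f, of "v - u"] by simp
    have sub: "{v. ?p v \<noteq> 0} \<subseteq> (+) u ` {d. c d \<noteq> 0}"
    proof
      fix v assume "v \<in> {v. ?p v \<noteq> 0}"
      then have "c (v - u) \<noteq> 0" using fH by auto
      then show "v \<in> (+) u ` {d. c d \<noteq> 0}" by (intro image_eqI[of _ _ "v - u"]) auto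
    qed
    have finp: "finite {v. ?p v \<noteq> 0}"
      using finite_subset[OF sub] fin by blast
    have "f = f \<cdot> idm C a" using cmp_id[OF fH] by simp
    also have "\<dots> = (\<Sum>d | c d \<noteq> 0. f \<cdot> c d)"
      unfolding ideq by (rule cmp_sum_right[OF cH fH])
    also have "\<dots> = (\<Sum>v\<in>(+) u ` {d. c d \<noteq> 0}. ?p v)"
      by (subst sum.reindex) (auto simp: inj_on_def)
    also have "\<dots> = (\<Sum>v | ?p v \<noteq> 0. ?p v)"
      using sub fin by (intro sum_support) auto
    finally have "is_components a a f ?p"
      using D finp by (simp add: is_components_def)
    moreover have "is_components a a f ?q"
      using f by (rule is_components_homogeneous)
    ultimately have "?p = ?q" by (rule is_components_unique)
    from fun_cong[OF this, of u] show ?thesis by simp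
  qed
  have "f \<cdot> c 0 = f" if "f \<in> Hom C a a" for f
    using that
    by (induction rule: Hom_induct) (auto simp: hom cmp_add_left[OF cH])
  \<comment> \<open>The composite of the identity with \<open>c 0\<close> is the identity by the
    previous step and \<open>c 0\<close> by the unit law.\<close>
  from this[OF id_in] have "c 0 = idm C a" using id_cmp[OF cH] by simp
  then show ?thesis using cD by metis
qed

end

section \<open>Complexes as single matrices\<close>

context graded_monoidal_category
begin

section \<open>Composition of column-finite matrices\<close>

lemma sum_hom_entry: "F \<in> sum_hom C X Y \<Longrightarrow> F j i \<in> Hom C (snd X i) (snd Y j)"
  unfolding sum_hom_def by (cases "i \<in> fst X \<and> j \<in> fst Y") auto

lemma sum_hom_finite: "F \<in> sum_hom C X Y \<Longrightarrow> finite {j. F j i \<noteq> 0}"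
  unfolding sum_hom_def by (cases "i \<in> fst X") auto

lemma sum_hom_support: "F \<in> sum_hom C X Y \<Longrightarrow> F j i \<noteq> 0 \<Longrightarrow> i \<in> fst X \<and> j \<in> fst Y"
  unfolding sum_hom_def by auto

lemma sum_homI:
  assumes "\<And>i j. F j i \<in> Hom C (snd X i) (snd Y j)"
    and "\<And>i j. F j i \<noteq> 0 \<Longrightarrow> i \<in> fst X \<and> j \<in> fst Y"
    and "\<And>i. finite {j. F j i \<noteq> 0}"
  shows "F \<in> sum_hom C X Y"
  using assms unfolding sum_hom_def by blast

text \<open>Products with a zero factor vanish, so the summation may run over any finite set
  containing the indices where both factors are nonzero. This allows sums over different supports to
  be brought to a common index set.\<close>

lemma sum_cmp_eq:
  assumes F: "F \<in> sum_hom C X Y" and G: "G \<in> sum_hom C Y Z"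
    and S: "finite S" "\<And>j. F j i \<noteq> 0 \<Longrightarrow> G l j \<noteq> 0 \<Longrightarrow> j \<in> S"
  shows "sum_cmp C G F l i = (\<Sum>j\<in>S. G l j \<cdot> F j i)"
proof -
  have zero: "G l j \<cdot> F j i = 0" if "F j i = 0 \<or> G l j = 0" for j
    using that cmp_zero(1)[OF sum_hom_entry[OF G, of l j]] cmp_zero(2)[OF sum_hom_entry[OF F, of j i]]
    by metis
  have "(\<Sum>j | F j i \<noteq> 0. G l j \<cdot> F j i) = (\<Sum>j\<in>S \<union> {j. F j i \<noteq> 0}. G l j \<cdot> F j i)"
    by (rule sum.mono_neutral_left) (use S(1) sum_hom_finite[OF F, of i] zero in \<open>blast intro: finite_UnI\<close>)+
  also have "\<dots> = (\<Sum>j\<in>S. G l j \<cdot> F j i)"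
    by (rule sum.mono_neutral_right)
      (use S sum_hom_finite[OF F, of i] zero in \<open>blast intro: finite_UnI\<close>)+
  finally show ?thesis by (simp add: sum_cmp_def)
qed

lemma sum_cmp_single:
  assumes "F \<in> sum_hom C X Y" "G \<in> sum_hom C Y Z"
    and "\<And>j'. F j' i \<noteq> 0 \<Longrightarrow> G l j' \<noteq> 0 \<Longrightarrow> j' = j"
  shows "sum_cmp C G F l i = G l j \<cdot> F j i"
  using sum_cmp_eq[OF assms(1,2), of "{j}" i l] assms(3) by simp

lemma sum_cmp_eq_zero:
  assumes "F \<in> sum_hom C X Y" "G \<in> sum_hom C Y Z"
    and "\<And>j. F j i \<noteq> 0 \<Longrightarrow> G l j \<noteq> 0 \<Longrightarrow> False"
  shows "sum_cmp C G F l i = 0"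
  using sum_cmp_eq[OF assms(1,2), of "{}" i l] assms(3) by auto

lemma sum_cmp_nonzero:
  assumes "F \<in> sum_hom C X Y" "G \<in> sum_hom C Y Z" "sum_cmp C G F l i \<noteq> 0"
  obtains j where "F j i \<noteq> 0" "G l j \<noteq> 0"
  using sum_cmp_eq_zero[OF assms(1,2)] assms(3) by blast

lemma sum_cmp_in:
  assumes F: "F \<in> sum_hom C X Y" and G: "G \<in> sum_hom C Y Z"
  shows "sum_cmp C G F \<in> sum_hom C X Z"
proof (rule sum_homI)
  fix i l
  show "sum_cmp C G F l i \<in> Hom C (snd X i) (snd Z l)"
    unfolding sum_cmp_def by (rule sum_Hom) (rule cmp_in[OF sum_hom_entry[OF F] sum_hom_entry[OF G]])
  show "i \<in> fst X \<and> l \<in> fst Z" if nz: "sum_cmp C G F l i \<noteq> 0"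
    by (rule sum_cmp_nonzero[OF F G nz]) (use sum_hom_support[OF F] sum_hom_support[OF G] in blast)
next
  fix i
  have sub: "{l. sum_cmp C G F l i \<noteq> 0} \<subseteq> (\<Union>j\<in>{j. F j i \<noteq> 0}. {l. G l j \<noteq> 0})"
    by (auto elim: sum_cmp_nonzero[OF F G])
  show "finite {l. sum_cmp C G F l i \<noteq> 0}"
    by (rule finite_subset[OF sub]) (simp add: sum_hom_finite[OF F] sum_hom_finite[OF G])
qed

lemma sum_cmp_assoc:
  assumes F: "F \<in> sum_hom C X Y" and G: "G \<in> sum_hom C Y Z" and H: "H \<in> sum_hom C Z W"
  shows "sum_cmp C (sum_cmp C H G) F = sum_cmp C H (sum_cmp C G F)"
proof (intro ext)
  fix m i
  \<comment> \<open>\<open>?T\<close> collects everything \<open>G\<close> reaches from column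
    \<open>i\<close> of \<open>F\<close>. It is finite and independent of \<open>j\<close>, so the
    two summations can be exchanged.\<close>
  let ?S = "{j. F j i \<noteq> 0}" let ?T = "\<Union>j\<in>?S. {l. G l j \<noteq> 0}"
  have S: "finite ?S" by (rule sum_hom_finite[OF F])
  then have T: "finite ?T" by (simp add: sum_hom_finite[OF G])
  have "sum_cmp C (sum_cmp C H G) F m i = (\<Sum>j\<in>?S. sum_cmp C H G m j \<cdot> F j i)"
    by (simp add: sum_cmp_def)
  also have "\<dots> = (\<Sum>j\<in>?S. (\<Sum>l\<in>?T. H m l \<cdot> G l j) \<cdot> F j i)"
    by (intro sum.cong refl arg_cong[where f = "\<lambda>x. x \<cdot> _"] sum_cmp_eq[OF G H T]) auto
  also have "\<dots> = (\<Sum>j\<in>?S. \<Sum>l\<in>?T. H m l \<cdot> (G l j \<cdot> F j i))"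
    by (simp add: cmp_sum_left[OF sum_hom_entry[OF F] cmp_in[OF sum_hom_entry[OF G] sum_hom_entry[OF H]]]
        cmp_assoc[OF sum_hom_entry[OF F] sum_hom_entry[OF G] sum_hom_entry[OF H]])
  also have "\<dots> = (\<Sum>l\<in>?T. \<Sum>j\<in>?S. H m l \<cdot> (G l j \<cdot> F j i))"
    by (rule sum.swap)
  also have "\<dots> = (\<Sum>l\<in>?T. H m l \<cdot> sum_cmp C G F l i)"
    by (simp add: sum_cmp_def
        cmp_sum_right[OF cmp_in[OF sum_hom_entry[OF F] sum_hom_entry[OF G]] sum_hom_entry[OF H]])
  also have "\<dots> = sum_cmp C H (sum_cmp C G F) m i"
    by (rule sum_cmp_eq[OF sum_cmp_in[OF F G] H T, symmetric])
      (auto elim: sum_cmp_nonzero[OF F G])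
  finally show "sum_cmp C (sum_cmp C H G) F m i = sum_cmp C H (sum_cmp C G F) m i" .
qed

lemma zero_sum_hom [simp]: "0 \<in> sum_hom C X Y"
  by (simp add: sum_hom_def)

lemma add_sum_hom [simp]:
  assumes F: "F \<in> sum_hom C X Y" and F': "F' \<in> sum_hom C X Y"
  shows "F + F' \<in> sum_hom C X Y"
proof (rule sum_homI)
  fix i j
  show "(F + F') j i \<in> Hom C (snd X i) (snd Y j)"
    using sum_hom_entry[OF F] sum_hom_entry[OF F'] by simp
  show "i \<in> fst X \<and> j \<in> fst Y" if "(F + F') j i \<noteq> 0"
    using that sum_hom_support[OF F, of j i] sum_hom_support[OF F', of j i] by fastforce
next
  fix i
  have "{j. (F + F') j i \<noteq> 0} \<subseteq> {j. F j i \<noteq> 0} \<union> {j. F' j i \<noteq> 0}" by auto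
  then show "finite {j. (F + F') j i \<noteq> 0}"
    by (rule finite_subset) (simp add: sum_hom_finite[OF F] sum_hom_finite[OF F'])
qed

lemma sum_cmp_add_right:
  assumes F: "F \<in> sum_hom C X Y" "F' \<in> sum_hom C X Y" and G: "G \<in> sum_hom C Y Z"
  shows "sum_cmp C G (F + F') = sum_cmp C G F + sum_cmp C G F'"
proof (intro ext)
  fix l i
  let ?S = "{j. F j i \<noteq> 0} \<union> {j. F' j i \<noteq> 0}"
  have S: "finite ?S" by (simp add: sum_hom_finite[OF F(1)] sum_hom_finite[OF F(2)])
  have "sum_cmp C G (F + F') l i = (\<Sum>j\<in>?S. G l j \<cdot> (F + F') j i)"
    by (rule sum_cmp_eq[OF add_sum_hom[OF F] G S]) auto
  also have "\<dots> = (\<Sum>j\<in>?S. G l j \<cdot> F j i) + (\<Sum>j\<in>?S. G l j \<cdot> F' j i)"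
    by (simp add: cmp_add_right[OF sum_hom_entry[OF F(1)] sum_hom_entry[OF F(2)] sum_hom_entry[OF G]]
        sum.distrib)
  also have "(\<Sum>j\<in>?S. G l j \<cdot> F j i) = sum_cmp C G F l i"
    by (rule sum_cmp_eq[OF F(1) G S, symmetric]) auto
  also have "(\<Sum>j\<in>?S. G l j \<cdot> F' j i) = sum_cmp C G F' l i"
    by (rule sum_cmp_eq[OF F(2) G S, symmetric]) auto
  finally show "sum_cmp C G (F + F') l i = (sum_cmp C G F + sum_cmp C G F') l i"
    unfolding plus_fun_apply .
qed

lemma sum_cmp_add_left:
  assumes F: "F \<in> sum_hom C X Y" and G: "G \<in> sum_hom C Y Z" "G' \<in> sum_hom C Y Z"
  shows "sum_cmp C (G + G') F = sum_cmp C G F + sum_cmp C G' F"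
  by (intro ext) (simp add: sum_cmp_def sum.distrib
      cmp_add_left[OF sum_hom_entry[OF F] sum_hom_entry[OF G(1)] sum_hom_entry[OF G(2)]])

lemma sum_id_in [simp]: "sum_id C X \<in> sum_hom C X X"
proof (rule sum_homI)
  show "finite {j. sum_id C X j i \<noteq> 0}" for i
    by (rule finite_subset[of _ "{i}"]) (auto simp: sum_id_def)
qed (auto simp: sum_id_def id_in split: if_splits)

lemma sum_cmp_id:
  assumes F: "F \<in> sum_hom C X Y"
  shows "sum_cmp C F (sum_id C X) = F" "sum_cmp C (sum_id C Y) F = F"
proof -
  show "sum_cmp C F (sum_id C X) = F"
  proof (intro ext)
    fix j i
    have "sum_cmp C F (sum_id C X) j i = F j i \<cdot> sum_id C X i i"
      by (rule sum_cmp_single[OF sum_id_in F]) (auto simp: sum_id_def split: if_splits)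
    then show "sum_cmp C F (sum_id C X) j i = F j i"
      using sum_hom_entry[OF F, of j i] sum_hom_support[OF F, of j i]
      by (auto simp: sum_id_def cmp_id)
  qed
  show "sum_cmp C (sum_id C Y) F = F"
  proof (intro ext)
    fix j i
    have "sum_cmp C (sum_id C Y) F j i = sum_id C Y j j \<cdot> F j i"
      by (rule sum_cmp_single[OF F sum_id_in]) (auto simp: sum_id_def split: if_splits)
    then show "sum_cmp C (sum_id C Y) F j i = F j i"
      using sum_hom_entry[OF F, of j i] sum_hom_support[OF F, of j i]
      by (auto simp: sum_id_def id_cmp)
  qed
qed

text \<open>A whole family of maps of degree \<open>k\<close>, one for each total degree, is stored
  as a single matrix. This suits tensor products, where a point of given total degree splits into
  parts whose separate total degrees are not fixed.\<close>

definition deg_hom :: "int \<Rightarrow> (int list, 'o) formal_sum \<Rightarrow> (int list, 'o) formal_sum \<Rightarrow>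
    (int list \<Rightarrow> int list \<Rightarrow> 'm) set" where
  "deg_hom k X Y = {F \<in> sum_hom C X Y. \<forall>j i. F j i \<noteq> 0 \<longrightarrow> sum_list j = sum_list i + k}"

lemma deg_hom_sum_hom: "F \<in> deg_hom k X Y \<Longrightarrow> F \<in> sum_hom C X Y"
  by (simp add: deg_hom_def)

lemma deg_hom_degree: "F \<in> deg_hom k X Y \<Longrightarrow> F j i \<noteq> 0 \<Longrightarrow> sum_list j = sum_list i + k"
  by (simp add: deg_hom_def)

lemma deg_hom_cmp:
  assumes F: "F \<in> deg_hom k X Y" and G: "G \<in> deg_hom l Y Z"
  shows "sum_cmp C G F \<in> deg_hom (k + l) X Z"
  using sum_cmp_in[OF deg_hom_sum_hom[OF F] deg_hom_sum_hom[OF G]]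
    sum_cmp_nonzero[OF deg_hom_sum_hom[OF F] deg_hom_sum_hom[OF G]]
    deg_hom_degree[OF F] deg_hom_degree[OF G]
  unfolding deg_hom_def by (smt (verit, best) mem_Collect_eq)

lemma deg_hom_id: "sum_id C X \<in> deg_hom 0 X X"
  using sum_id_in[of X] by (auto simp: deg_hom_def) (simp add: sum_id_def split: if_splits)

lemma deg_hom_add: "F \<in> deg_hom k X Y \<Longrightarrow> F' \<in> deg_hom k X Y \<Longrightarrow> F + F' \<in> deg_hom k X Y"
  by (auto simp: deg_hom_def) (metis add_0)

text \<open>Homotopy equivalence for merged families: the index \<open>t\<close> disappears, and
  every condition becomes an equation between single matrices.\<close>

definition equivalent :: "(int list, 'o) formal_sum \<Rightarrow> (int list \<Rightarrow> int list \<Rightarrow> 'm) \<Rightarrow>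
    (int list, 'o) formal_sum \<Rightarrow> (int list \<Rightarrow> int list \<Rightarrow> 'm) \<Rightarrow> bool" where
  "equivalent X D Y E \<longleftrightarrow>
     D \<in> deg_hom 1 X X \<and> sum_cmp C D D = 0 \<and> E \<in> deg_hom 1 Y Y \<and> sum_cmp C E E = 0 \<and>
     (\<exists>F G H K. F \<in> deg_hom 0 X Y \<and> G \<in> deg_hom 0 Y X \<and>
        H \<in> deg_hom (- 1) X X \<and> K \<in> deg_hom (- 1) Y Y \<and>
        sum_cmp C E F = sum_cmp C F D \<and> sum_cmp C D G = sum_cmp C G E \<and>
        sum_cmp C G F = sum_id C X + (sum_cmp C D H + sum_cmp C H D) \<and>
        sum_cmp C F G = sum_id C Y + (sum_cmp C E K + sum_cmp C K E))"

text \<open>If \<open>P\<close> is homotopic to the identity through \<open>K\<close>, then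
  \<open>G P F\<close> is homotopic to \<open>G F\<close> through \<open>G K F\<close>, since
  \<open>F\<close> and \<open>G\<close> commute with the differentials. Adding \<open>H\<close>
  gives the homotopy to the identity.\<close>

lemma homotopy_conjugate:
  assumes F: "F \<in> deg_hom 0 X Y" and G: "G \<in> deg_hom 0 Y X" and K: "K \<in> deg_hom (- 1) Y Y"
    and D: "D \<in> deg_hom 1 X X" and E: "E \<in> deg_hom 1 Y Y"
    and EF: "sum_cmp C E F = sum_cmp C F D" and DG: "sum_cmp C D G = sum_cmp C G E"
    and P: "P \<in> deg_hom 0 Y Y" "P = sum_id C Y + (sum_cmp C E K + sum_cmp C K E)"
    and H: "H \<in> deg_hom (- 1) X X" "sum_cmp C G F = sum_id C X + (sum_cmp C D H + sum_cmp C H D)"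
  shows "\<exists>L \<in> deg_hom (- 1) X X. sum_cmp C G (sum_cmp C P F) =
    sum_id C X + (sum_cmp C D L + sum_cmp C L D)"
proof -
  note s = deg_hom_sum_hom
  note [simp] = F[THEN s] G[THEN s] K[THEN s] D[THEN s] E[THEN s] P(1)[THEN s] H(1)[THEN s]
  let ?M = "sum_cmp C G (sum_cmp C K F)"
  have M: "?M \<in> deg_hom (- 1) X X"
    using deg_hom_cmp[OF deg_hom_cmp[OF F K] G] by simp
  note [simp] = M[THEN s]
  have KF: "sum_cmp C K F \<in> sum_hom C X Y"
    and EK: "sum_cmp C E K \<in> sum_hom C Y Y" "sum_cmp C K E \<in> sum_hom C Y Y"
    by (rule sum_cmp_in[of _ _ Y]; simp)+
  note asc = sum_cmp_assoc
  have "sum_cmp C G (sum_cmp C (sum_cmp C E K) F) = sum_cmp C G (sum_cmp C E (sum_cmp C K F))"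
    using asc[of F X Y K Y E Y] by simp
  also have "\<dots> = sum_cmp C (sum_cmp C D G) (sum_cmp C K F)"
    using asc[OF KF, of E Y G X] DG by simp
  also have "\<dots> = sum_cmp C D ?M"
    using asc[OF KF, of G X D X] by simp
  finally have a: "sum_cmp C G (sum_cmp C (sum_cmp C E K) F) = sum_cmp C D ?M" .
  have "sum_cmp C G (sum_cmp C (sum_cmp C K E) F) = sum_cmp C G (sum_cmp C K (sum_cmp C F D))"
    using asc[of F X Y E Y K Y] EF by simp
  also have "\<dots> = sum_cmp C G (sum_cmp C (sum_cmp C K F) D)"
    using asc[of D X X F Y K Y] by simp
  also have "\<dots> = sum_cmp C ?M D"
    using asc[of D X X, OF _ KF, of G X] by simp
  finally have b: "sum_cmp C G (sum_cmp C (sum_cmp C K E) F) = sum_cmp C ?M D" .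
  have EKF: "sum_cmp C (sum_cmp C E K) F \<in> sum_hom C X Y" "sum_cmp C (sum_cmp C K E) F \<in> sum_hom C X Y"
    using sum_cmp_in[of F X Y] EK by simp_all
  have "sum_cmp C G (sum_cmp C P F) =
      sum_cmp C G (F + (sum_cmp C (sum_cmp C E K) F + sum_cmp C (sum_cmp C K E) F))"
    unfolding P(2)
    by (simp add: sum_cmp_add_left[of F X Y _ Y] EK sum_cmp_id[of F X Y])
  also have "\<dots> = sum_cmp C G F + (sum_cmp C D ?M + sum_cmp C ?M D)"
    by (simp add: sum_cmp_add_right[of _ X Y _ G X] EKF a b)
  also have "\<dots> = sum_id C X + (sum_cmp C D (H + ?M) + sum_cmp C (H + ?M) D)"
    unfolding H(2) by (simp add: sum_cmp_add_right[of _ X X _ D X] sum_cmp_add_left[of D X X _ X] ac_simps)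
  finally show ?thesis using deg_hom_add[OF H(1) M] by blast
qed

text \<open>Each round trip through the composites has the other equivalence's round trip in its
  middle, so \<open>homotopy_conjugate\<close> applies twice, with \<open>P\<close> equal to
  \<open>G' F'\<close> and to \<open>F G\<close>.\<close>

lemma equivalent_trans:
  assumes "equivalent X D Y E" "equivalent Y E Z D'"
  shows "equivalent X D Z D'"
proof -
  note s = deg_hom_sum_hom
  obtain F G H K where D: "D \<in> deg_hom 1 X X" "sum_cmp C D D = 0" and E: "E \<in> deg_hom 1 Y Y"
    and F: "F \<in> deg_hom 0 X Y" and G: "G \<in> deg_hom 0 Y X"
    and H: "H \<in> deg_hom (- 1) X X" and K: "K \<in> deg_hom (- 1) Y Y"
    and EF: "sum_cmp C E F = sum_cmp C F D" and DG: "sum_cmp C D G = sum_cmp C G E"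
    and GF: "sum_cmp C G F = sum_id C X + (sum_cmp C D H + sum_cmp C H D)"
    and FG: "sum_cmp C F G = sum_id C Y + (sum_cmp C E K + sum_cmp C K E)"
    using assms(1) unfolding equivalent_def by (elim conjE exE)
  obtain F' G' H' K' where D': "D' \<in> deg_hom 1 Z Z" "sum_cmp C D' D' = 0"
    and F': "F' \<in> deg_hom 0 Y Z" and G': "G' \<in> deg_hom 0 Z Y"
    and H': "H' \<in> deg_hom (- 1) Y Y" and K': "K' \<in> deg_hom (- 1) Z Z"
    and EF': "sum_cmp C D' F' = sum_cmp C F' E" and DG': "sum_cmp C E G' = sum_cmp C G' D'"
    and GF': "sum_cmp C G' F' = sum_id C Y + (sum_cmp C E H' + sum_cmp C H' E)"
    and FG': "sum_cmp C F' G' = sum_id C Z + (sum_cmp C D' K' + sum_cmp C K' D')"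
    using assms(2) unfolding equivalent_def by (elim conjE exE)
  note [simp] = D(1)[THEN s] E[THEN s] F[THEN s] G[THEN s] D'(1)[THEN s] F'[THEN s] G'[THEN s]
  let ?F = "sum_cmp C F' F" and ?G = "sum_cmp C G G'"
  have FF: "?F \<in> deg_hom 0 X Z" and GG: "?G \<in> deg_hom 0 Z X"
    using deg_hom_cmp[OF F F'] deg_hom_cmp[OF G' G] by simp_all
  note [simp] = FF[THEN s] GG[THEN s]
  have GF'': "sum_cmp C G' F' \<in> deg_hom 0 Y Y" and FG'': "sum_cmp C F G \<in> deg_hom 0 Y Y"
    using deg_hom_cmp[OF F' G'] deg_hom_cmp[OF G F] by simp_all
  note asc = sum_cmp_assoc
  have "sum_cmp C D' ?F = sum_cmp C (sum_cmp C F' E) F"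
    using asc[of F X Y F' Z D' Z] EF' by simp
  also have "\<dots> = sum_cmp C F' (sum_cmp C F D)"
    using asc[of F X Y E Y F' Z] EF by simp
  also have "\<dots> = sum_cmp C ?F D"
    using asc[of D X X F Y F' Z] by simp
  finally have 1: "sum_cmp C D' ?F = sum_cmp C ?F D" .
  have "sum_cmp C D ?G = sum_cmp C (sum_cmp C G E) G'"
    using asc[of G' Z Y G X D X] DG by simp
  also have "\<dots> = sum_cmp C G (sum_cmp C G' D')"
    using asc[of G' Z Y E Y G X] DG' by simp
  also have "\<dots> = sum_cmp C ?G D'"
    using asc[of D' Z Z G' Y G X] by simp
  finally have 2: "sum_cmp C D ?G = sum_cmp C ?G D'" .
  have 3: "sum_cmp C ?G ?F = sum_cmp C G (sum_cmp C (sum_cmp C G' F') F)"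
    using asc[of ?F X Z G' Y G X] asc[of F X Y F' Z G' Y] by simp
  have 4: "sum_cmp C ?F ?G = sum_cmp C F' (sum_cmp C (sum_cmp C F G) G')"
    using asc[of ?G Z X F Y F' Z] asc[of G' Z Y G X F Y] by simp
  obtain L where L: "L \<in> deg_hom (- 1) X X"
    "sum_cmp C G (sum_cmp C (sum_cmp C G' F') F) = sum_id C X + (sum_cmp C D L + sum_cmp C L D)"
    using homotopy_conjugate[OF F G H' D(1) E EF DG GF'' GF' H GF] by blast
  obtain M where M: "M \<in> deg_hom (- 1) Z Z"
    "sum_cmp C F' (sum_cmp C (sum_cmp C F G) G') = sum_id C Z + (sum_cmp C D' M + sum_cmp C M D')"
    using homotopy_conjugate[OF G' F' K D'(1) E DG' EF' FG'' FG K' FG'] by blast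
  show ?thesis
    unfolding equivalent_def
    by (intro exI[of _ ?F] exI[of _ ?G] exI[of _ L] exI[of _ M] conjI D D' FF GG L(1) M(1) 1 2)
      (simp_all only: 3 4 L(2) M(2))
qed

section \<open>Passing between families of matrices and single matrices\<close>

definition slice :: "int \<Rightarrow> (int list \<Rightarrow> int list \<Rightarrow> 'm) \<Rightarrow> int list \<Rightarrow> int list \<Rightarrow> 'm" where
  "slice t F = (\<lambda>j i. if sum_list i = t then F j i else 0)"

definition slices :: "(int list, 'o) formal_sum \<Rightarrow> int \<Rightarrow> (int list, 'o) formal_sum" where
  "slices X t = ({i \<in> fst X. sum_list i = t}, snd X)"

definition split_complex :: "(int list, 'o) formal_sum \<Rightarrow> (int list \<Rightarrow> int list \<Rightarrow> 'm) \<Rightarrow>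
    (int list, 'o, 'm) complex" where
  "split_complex X D = \<lparr>cobj = slices X, cdiff = (\<lambda>t. slice t D)\<rparr>"

lemma slice_in:
  assumes F: "F \<in> deg_hom k X Y"
  shows "slice t F \<in> sum_hom C (slices X t) (slices Y (t + k))"
proof -
  note F' = deg_hom_sum_hom[OF F]
  show ?thesis
  proof (rule sum_homI)
    fix i j
    show "slice t F j i \<in> Hom C (snd (slices X t) i) (snd (slices Y (t + k)) j)"
      using sum_hom_entry[OF F', of j i] by (simp add: slice_def slices_def)
    show "finite {j. slice t F j i \<noteq> 0}"
      using sum_hom_finite[OF F', of i] by (simp add: slice_def)
    show "i \<in> fst (slices X t) \<and> j \<in> fst (slices Y (t + k))" if "slice t F j i \<noteq> 0"
      using that sum_hom_support[OF F', of j i] deg_hom_degree[OF F, of j i]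
      by (simp add: slice_def slices_def split: if_splits)
  qed
qed

lemma deg_homI:
  assumes "\<And>t. slice t F \<in> sum_hom C (slices X t) (slices Y (t + k))"
  shows "F \<in> deg_hom k X Y"
proof -
  note e = sum_hom_entry[OF assms] and s = sum_hom_support[OF assms] and f = sum_hom_finite[OF assms]
  have "F \<in> sum_hom C X Y"
  proof (rule sum_homI)
    fix i j
    show "F j i \<in> Hom C (snd X i) (snd Y j)"
      using e[of "sum_list i" j i] by (simp add: slice_def slices_def)
    show "finite {j. F j i \<noteq> 0}"
      using f[of "sum_list i" i] by (simp add: slice_def)
    show "i \<in> fst X \<and> j \<in> fst Y" if "F j i \<noteq> 0"
      using that s[of "sum_list i" j i] by (simp add: slice_def slices_def)
  qed
  moreover have "sum_list j = sum_list i + k" if "F j i \<noteq> 0" for i j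
    using that s[of "sum_list i" j i] by (simp add: slice_def slices_def)
  ultimately show ?thesis by (simp add: deg_hom_def)
qed

lemma slice_family:
  assumes "\<And>t. f t \<in> sum_hom C (slices X t) (slices Y (t + k))"
  obtains F where "F \<in> deg_hom k X Y" "f = (\<lambda>t. slice t F)"
proof -
  \<comment> \<open>Column \<open>i\<close> occurs only in the member of the family with index
    \<open>sum_list i\<close>, so gluing loses nothing.\<close>
  let ?F = "\<lambda>j i. f (sum_list i) j i"
  have f: "slice t ?F = f t" for t
  proof (intro ext)
    fix j i
    show "slice t ?F j i = f t j i"
      using sum_hom_support[OF assms, of t j i] by (auto simp: slice_def slices_def)
  qed
  then have "?F \<in> deg_hom k X Y" using assms by (intro deg_homI) simp
  then show ?thesis using that[of ?F] f by presburger
qed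

text \<open>The nonzero rows of \<open>slice t F\<close> have total degree \<open>t + k\<close>, and
  on those columns \<open>slice (t + k) G\<close> agrees with \<open>G\<close>.\<close>

lemma slice_cmp:
  assumes F: "F \<in> deg_hom k X Y"
  shows "sum_cmp C (slice (t + k) G) (slice t F) = slice t (sum_cmp C G F)"
proof (intro ext)
  fix l i
  show "sum_cmp C (slice (t + k) G) (slice t F) l i = slice t (sum_cmp C G F) l i"
    using deg_hom_degree[OF F] by (auto simp: sum_cmp_def slice_def intro!: sum.cong)
qed

lemma slice_eq_iff: "F = G \<longleftrightarrow> (\<forall>t. slice t F = slice t G)"
  by (auto simp: slice_def fun_eq_iff)

lemma slice_add: "slice t (F + G) = slice t F + slice t G"
  by (auto simp: slice_def fun_eq_iff)

lemma slice_id: "sum_id C (slices X t) = slice t (sum_id C X)"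
  by (auto simp: slice_def slices_def sum_id_def fun_eq_iff)

lemma slice_zero: "slice t 0 = 0"
  by (auto simp: slice_def fun_eq_iff)

lemma is_complex_split:
  "is_complex C (split_complex X D) \<longleftrightarrow> D \<in> deg_hom 1 X X \<and> sum_cmp C D D = 0"
proof -
  have D: "D \<in> deg_hom 1 X X" if "is_complex C (split_complex X D)"
    using that by (intro deg_homI) (simp add: is_complex_def split_complex_def)
  have "sum_cmp C D D = 0 \<longleftrightarrow> (\<forall>t. sum_cmp C (slice (t + 1) D) (slice t D) = (\<lambda>j i. 0))"
    if "D \<in> deg_hom 1 X X"
    by (simp add: slice_cmp[OF that] slice_eq_iff[of "sum_cmp C D D"] slice_zero flip: zero_fun_def)
  then show ?thesis
    using D slice_in[of D 1 X X] by (auto simp: is_complex_def split_complex_def)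
qed

lemma chain_map_split:
  assumes D: "D \<in> deg_hom 1 X X" and F: "F \<in> deg_hom 0 X Y"
  shows "chain_map C (split_complex X D) (split_complex Y E) (\<lambda>t. slice t F) \<longleftrightarrow>
    sum_cmp C E F = sum_cmp C F D"
  using slice_in[OF F] slice_cmp[OF F, of _ E] slice_cmp[OF D, of _ F]
  by (simp add: chain_map_def split_complex_def slice_eq_iff[of "sum_cmp C E F"])

lemma homotopic_split:
  assumes D: "D \<in> deg_hom 1 X X"
  shows "homotopic C (split_complex X D) (split_complex X D) (\<lambda>t. slice t P)
      (\<lambda>t. sum_id C (cobj (split_complex X D) t)) \<longleftrightarrow>
    (\<exists>H \<in> deg_hom (- 1) X X. P = sum_id C X + (sum_cmp C D H + sum_cmp C H D))"
proof -
  have eq: "(\<forall>j i. slice t P j i - sum_id C (cobj (split_complex X D) t) j i =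
      sum_cmp C (cdiff (split_complex X D) (t - 1)) (slice t H) j i +
      sum_cmp C (slice (t + 1) H) (cdiff (split_complex X D) t) j i) \<longleftrightarrow>
    slice t P = slice t (sum_id C X + (sum_cmp C D H + sum_cmp C H D))"
    if H: "H \<in> deg_hom (- 1) X X" for t H
    using slice_cmp[OF H, of t D] slice_cmp[OF D, of t H]
    by (simp add: split_complex_def slice_id slice_add fun_eq_iff diff_eq_eq ac_simps)
  show ?thesis
  proof
    assume "homotopic C (split_complex X D) (split_complex X D) (\<lambda>t. slice t P)
      (\<lambda>t. sum_id C (cobj (split_complex X D) t))"
    then obtain h where h: "\<And>t. h t \<in> sum_hom C (slices X t) (slices X (t + - 1))"
      and hh: "\<And>t j i. slice t P j i - sum_id C (cobj (split_complex X D) t) j i =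
      sum_cmp C (cdiff (split_complex X D) (t - 1)) (h t) j i +
      sum_cmp C (h (t + 1)) (cdiff (split_complex X D) t) j i"
      unfolding homotopic_def by (auto simp: split_complex_def)
    obtain H where H: "H \<in> deg_hom (- 1) X X" "h = (\<lambda>t. slice t H)"
      using slice_family[OF h] by blast
    then show "\<exists>H \<in> deg_hom (- 1) X X. P = sum_id C X + (sum_cmp C D H + sum_cmp C H D)"
      using hh eq[OF H(1)] slice_eq_iff[of P] by auto
  next
    assume "\<exists>H \<in> deg_hom (- 1) X X. P = sum_id C X + (sum_cmp C D H + sum_cmp C H D)"
    then obtain H where H: "H \<in> deg_hom (- 1) X X"
      and P: "P = sum_id C X + (sum_cmp C D H + sum_cmp C H D)" by blast
    show "homotopic C (split_complex X D) (split_complex X D) (\<lambda>t. slice t P)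
      (\<lambda>t. sum_id C (cobj (split_complex X D) t))"
      unfolding homotopic_def
    proof (intro exI[of _ "\<lambda>t. slice t H"] conjI allI)
      show "slice t H \<in> sum_hom C (cobj (split_complex X D) t) (cobj (split_complex X D) (t - 1))" for t
        using slice_in[OF H, of t] by (simp add: split_complex_def)
    qed (use eq[OF H] P in blast)
  qed
qed

lemma homotopy_equivalent_split:
  "homotopy_equivalent C (split_complex X D) (split_complex Y E) \<longleftrightarrow> equivalent X D Y E"
\<comment> \<open>Each side entails that both differentials have degree one, so otherwise both sides
  are false.\<close>
proof (cases "D \<in> deg_hom 1 X X \<and> E \<in> deg_hom 1 Y Y")
  case False
  then show ?thesis by (auto simp: homotopy_equivalent_def is_complex_split equivalent_def)
next
  case True
  then have D: "D \<in> deg_hom 1 X X" and E: "E \<in> deg_hom 1 Y Y" by auto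
  have cmp: "(\<lambda>t. sum_cmp C (slice t G) (slice t F)) = (\<lambda>t. slice t (sum_cmp C G F))"
    if "F \<in> deg_hom 0 X Y" for F G X Y
    using slice_cmp[OF that] by (simp add: fun_eq_iff)
  show ?thesis
  proof
    assume l: "homotopy_equivalent C (split_complex X D) (split_complex Y E)"
    then obtain f g where f: "chain_map C (split_complex X D) (split_complex Y E) f"
      and g: "chain_map C (split_complex Y E) (split_complex X D) g"
      and gf: "homotopic C (split_complex X D) (split_complex X D) (\<lambda>t. sum_cmp C (g t) (f t))
        (\<lambda>t. sum_id C (cobj (split_complex X D) t))"
      and fg: "homotopic C (split_complex Y E) (split_complex Y E) (\<lambda>t. sum_cmp C (f t) (g t))
        (\<lambda>t. sum_id C (cobj (split_complex Y E) t))"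
      unfolding homotopy_equivalent_def by blast
    have "\<And>t. f t \<in> sum_hom C (slices X t) (slices Y (t + 0))"
      and "\<And>t. g t \<in> sum_hom C (slices Y t) (slices X (t + 0))"
      using f g by (simp_all add: chain_map_def split_complex_def)
    then obtain F G where F: "F \<in> deg_hom 0 X Y" "f = (\<lambda>t. slice t F)"
      and G: "G \<in> deg_hom 0 Y X" "g = (\<lambda>t. slice t G)"
      using slice_family by metis
    show "equivalent X D Y E"
      using l f g gf fg unfolding F(2) G(2) cmp[OF F(1)] cmp[OF G(1)]
        chain_map_split[OF D F(1)] chain_map_split[OF E G(1)] homotopic_split[OF D] homotopic_split[OF E]
      unfolding homotopy_equivalent_def is_complex_split equivalent_def using F(1) G(1) by blast
  next
    assume r: "equivalent X D Y E"
    then obtain F G where F: "F \<in> deg_hom 0 X Y" and G: "G \<in> deg_hom 0 Y X"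
      and *: "sum_cmp C E F = sum_cmp C F D" "sum_cmp C D G = sum_cmp C G E"
      "\<exists>H \<in> deg_hom (- 1) X X. sum_cmp C G F = sum_id C X + (sum_cmp C D H + sum_cmp C H D)"
      "\<exists>K \<in> deg_hom (- 1) Y Y. sum_cmp C F G = sum_id C Y + (sum_cmp C E K + sum_cmp C K E)"
      unfolding equivalent_def by blast
    show "homotopy_equivalent C (split_complex X D) (split_complex Y E)"
      unfolding homotopy_equivalent_def
    proof (intro conjI exI)
      show "chain_map C (split_complex X D) (split_complex Y E) (\<lambda>t. slice t F)"
        using * by (simp add: chain_map_split[OF D F])
      show "chain_map C (split_complex Y E) (split_complex X D) (\<lambda>t. slice t G)"
        using * by (simp add: chain_map_split[OF E G])
      show "homotopic C (split_complex X D) (split_complex X D)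
          (\<lambda>t. sum_cmp C (slice t G) (slice t F)) (\<lambda>t. sum_id C (cobj (split_complex X D) t))"
        using * by (simp only: cmp[OF F] homotopic_split[OF D])
      show "homotopic C (split_complex Y E) (split_complex Y E)
          (\<lambda>t. sum_cmp C (slice t F) (slice t G)) (\<lambda>t. sum_id C (cobj (split_complex Y E) t))"
        using * by (simp only: cmp[OF G] homotopic_split[OF E])
    qed (use r in \<open>auto simp: is_complex_split equivalent_def\<close>)
  qed
qed

end

section \<open>Degrees of lattice points\<close>

lemma length_shift [simp]: "length (shift i r) = length r"
  by (simp add: shift_def)

lemma shift_lattice [simp]: "shift i r \<in> lattice n \<longleftrightarrow> r \<in> lattice n"
  by (simp add: lattice_def)

lemma shift_eq_iff: "i < length r \<Longrightarrow> j < length r \<Longrightarrow> shift i r = shift j r \<longleftrightarrow> i = j"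
  unfolding shift_def by (metis add_cancel_right_right nth_list_update_eq nth_list_update_neq zero_neq_one)

lemma shift_append1: "i < length r \<Longrightarrow> shift i (r @ q) = shift i r @ q"
  by (simp add: shift_def list_update_append nth_append)

lemma shift_append2: "shift (length r + j) (r @ q) = r @ shift j q"
  by (simp add: shift_def list_update_append nth_append)

lemma lattice_append: "r \<in> lattice n \<Longrightarrow> q \<in> lattice m \<Longrightarrow> r @ q \<in> lattice (n + m)"
  by (simp add: lattice_def)

lemma lattice_appendE:
  assumes "p \<in> lattice (n + m)"
  obtains r q where "p = r @ q" "r \<in> lattice n" "q \<in> lattice m"
  using that[of "take n p" "drop n p"] assms by (simp add: lattice_def)

section \<open>Values of a cocycle along paths\<close>

lemma path_value_lattice: "path_value n \<psi> r s g \<Longrightarrow> r \<in> lattice n \<and> s \<in> lattice n"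
  by (induction rule: path_value.induct) auto

text \<open>The second path is the first premise, so that the induction runs over it and extends the
  fixed first path edge by edge.\<close>

lemma path_value_trans:
  "path_value n \<psi> s t h \<Longrightarrow> path_value n \<psi> r s g \<Longrightarrow> path_value n \<psi> r t (g + h)"
proof (induction rule: path_value.induct)
  case (forward r' s' g' i)
  then show ?case using path_value.forward[of n \<psi> r s' "g + g'" i] by (simp add: add.assoc)
next
  case (backward r' i s' g')
  then show ?case using path_value.backward[of n \<psi> r i s' "g + g'"] by (simp add: add_diff_eq)
qed simp

lemma path_value_sym: "path_value n \<psi> r s g \<Longrightarrow> path_value n \<psi> s r (- g)"
proof (induction rule: path_value.induct)
  case (empty r)
  then show ?case using path_value.empty by simp
next
  case (forward r s g i)
  then have s: "s \<in> lattice n" using path_value_lattice by blast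
  have "path_value n \<psi> (shift i s) s (0 - \<psi> i s)"
    using forward s by (intro path_value.backward path_value.empty) auto
  from path_value_trans[OF forward.IH this] show ?case by (simp add: algebra_simps)
next
  case (backward r i s g)
  have "path_value n \<psi> s (shift i s) (0 + \<psi> i s)"
    using backward by (intro path_value.forward path_value.empty) auto
  from path_value_trans[OF backward.IH this] show ?case by (simp add: algebra_simps)
qed

text \<open>Going out along one path and back along the other is a cycle, on which the cocycle
  vanishes.\<close>

lemma path_value_unique:
  assumes "cocycle n \<psi>" "path_value n \<psi> r s g" "path_value n \<psi> r s h"
  shows "g = h"
  using path_value_trans[OF path_value_sym[OF assms(3)] assms(2)] assms(1)
  unfolding cocycle_def by fastforce

lemma path_value_update:
  assumes "p \<in> lattice n" "i < n"
  shows "\<exists>g. path_value n \<psi> p (p[i := v]) g"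
\<comment> \<open>Starting from the present coordinate, larger values are reached by forward edges
  and smaller ones by backward edges.\<close>
proof (induction v rule: int_induct[where k = "p ! i"])
  case base
  show ?case using path_value.empty[OF assms(1)] by auto
next
  case (step1 v)
  have "shift i (p[i := v]) = p[i := v + 1]"
    using assms by (simp add: shift_def lattice_def)
  then show ?case using step1 path_value.forward assms(2) by metis
next
  case (step2 v)
  have "shift i (p[i := v - 1]) = p[i := v]"
    using assms by (simp add: shift_def lattice_def)
  moreover have "p[i := v - 1] \<in> lattice n" using assms by (simp add: lattice_def)
  ultimately show ?case using step2 path_value.backward assms(2) by metis
qed

lemma path_value_exists:
  assumes r: "r \<in> lattice n"
  shows "\<exists>g. path_value n \<psi> (replicate n 0) r g"
proof -
  \<comment> \<open>The path adjusts one coordinate at a time: after \<open>k\<close> stages the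
    first \<open>k\<close> coordinates are those of \<open>r\<close> and the rest are still
    zero.\<close>
  have "\<exists>g. path_value n \<psi> (replicate n 0) (take k r @ replicate (n - k) 0) g" if "k \<le> n" for k
    using that
  proof (induction k)
    case 0
    show ?case using path_value.empty[of "replicate n 0" n \<psi>] by (auto simp: lattice_def)
  next
    case (Suc k)
    then obtain g where g: "path_value n \<psi> (replicate n 0) (take k r @ replicate (n - k) 0) g"
      by auto
    have "(take k r @ replicate (n - k) 0)[k := r ! k] = take (Suc k) r @ replicate (n - Suc k) 0"
      using Suc.prems r
      by (intro nth_equalityI) (auto simp: lattice_def nth_append nth_list_update less_Suc_eq)
    moreover obtain h where "path_value n \<psi> (take k r @ replicate (n - k) 0)
        ((take k r @ replicate (n - k) 0)[k := r ! k]) h"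
      using path_value_update path_value_lattice[OF g] Suc.prems by (metis Suc_le_lessD)
    ultimately show ?case using path_value_trans[OF _ g] by metis
  qed
  from this[of n] r show ?thesis by (simp add: lattice_def)
qed

lemma total_deg_eq:
  assumes "cocycle (pdim A) (pcoc A)"
    and "path_value (pdim A) (pcoc A) (replicate (pdim A) 0) r g"
  shows "total_deg A r = g"
  unfolding total_deg_def using assms path_value_unique by blast

text \<open>A path from the origin is lengthened by one edge. This equation is what gives
  differentials normalized degree zero.\<close>

lemma total_deg_shift:
  assumes "cocycle (pdim A) (pcoc A)" "r \<in> lattice (pdim A)" "i < pdim A"
  shows "total_deg A (shift i r) = total_deg A r + pcoc A i r"
proof -
  obtain g where g: "path_value (pdim A) (pcoc A) (replicate (pdim A) 0) r g"
    using path_value_exists assms(2) by blast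
  then show ?thesis
    using total_deg_eq[OF assms(1)] path_value.forward[OF g assms(3)] by metis
qed

section \<open>The total differential as a single matrix\<close>

definition total_diff :: "('g, 'o, 'm::ab_group_add) polycomplex \<Rightarrow> int list \<Rightarrow> int list \<Rightarrow> 'm" where
  "total_diff A s r =
     (if r \<in> lattice (pdim A) then \<Sum>i | i < pdim A \<and> s = shift i r. pdiff A i r else 0)"

definition total_obj :: "('g, 'o, 'm) polycomplex \<Rightarrow> (int list, 'o) formal_sum" where
  "total_obj A = (lattice (pdim A), pobj A)"

text \<open>Shifts in different directions give different points, so the defining sum has a single
  term.\<close>

lemma total_diff_shift:
  assumes "r \<in> lattice (pdim A)" "i < pdim A"
  shows "total_diff A (shift i r) r = pdiff A i r"
proof -
  have "{j. j < pdim A \<and> shift i r = shift j r} = {i}"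
    using assms shift_eq_iff[of i r] by (auto simp: lattice_def)
  then show ?thesis using assms by (simp add: total_diff_def)
qed

lemma total_diff_nonzero:
  assumes "total_diff A s r \<noteq> 0"
  obtains i where "r \<in> lattice (pdim A)" "i < pdim A" "s = shift i r"
  using assms unfolding total_diff_def by (metis (mono_tags, lifting) empty_Collect_eq sum.empty)

context graded_monoidal_category
begin

lemma Tot_eq_split: "Tot A = split_complex (total_obj A) (total_diff A)"
  by (auto simp: Tot_def split_complex_def slices_def total_obj_def slice_def total_diff_def fun_eq_iff)

text \<open>This is normalized degree zero, which prescribes the degree of each entry and so asks
  for more than homogeneity of the entries.\<close>

definition homogeneous :: "('g, 'o, 'm) polycomplex \<Rightarrow> ('g, 'o, 'm) polycomplex \<Rightarrow>
    (int list \<Rightarrow> int list \<Rightarrow> 'm) \<Rightarrow> bool" where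
  "homogeneous A B F \<longleftrightarrow>
     (\<forall>s r. F s r \<in> HomD C (pobj A r) (pobj B s) (total_deg B s - total_deg A r))"

lemma homogeneous_total_diff:
  assumes "homogeneous_polycomplex C A"
  shows "homogeneous A A (total_diff A)"
  unfolding homogeneous_def
proof (intro allI)
  fix s r
  show "total_diff A s r \<in> HomD C (pobj A r) (pobj A s) (total_deg A s - total_deg A r)"
  proof (cases "total_diff A s r = 0")
    case False
    then obtain i where "r \<in> lattice (pdim A)" "i < pdim A" "s = shift i r"
      by (rule total_diff_nonzero)
    then show ?thesis
      using assms by (simp add: total_diff_shift total_deg_shift homogeneous_polycomplex_def)
  qed simp
qed

end

section \<open>Tensoring with an identity\<close>

context graded_monoidal_category
begin

text \<open>Since \<open>g\<close> has degree zero, the scalar in the interchange law is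
  \<open>1\<close> on homogeneous morphisms. What remains is additive in \<open>f\<close>,
  \<open>h\<close> and \<open>k\<close>, hence holds for all of them.\<close>

lemma interchange_left:
  assumes "h \<in> Hom C a b" "f \<in> Hom C b c" "k \<in> Hom C a' b'" "g \<in> HomD C b' c' 0"
  shows "(f \<otimes> g) \<cdot> (h \<otimes> k) = (f \<cdot> h) \<otimes> (g \<cdot> k)"
  using assms(1-3)
proof (induction h rule: Hom_induct)
  case (homogeneous w h)
  note h = homogeneous(1) HomD_Hom[OF homogeneous(1)] and g = assms(4) HomD_Hom[OF assms(4)]
  from homogeneous(2,3) show ?case
  proof (induction f rule: Hom_induct)
    case (homogeneous u f)
    note f = homogeneous(1) HomD_Hom[OF homogeneous(1)]
    from homogeneous(2) show ?case
    proof (induction k rule: Hom_induct)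
      case (homogeneous z k)
      note k = homogeneous(1) HomD_Hom[OF homogeneous(1)]
      show ?case
        using interchange[OF h(1) f(1) k(1) g(1)]
        by (simp add: scale_one[OF tmor_in[OF cmp_in[OF h(2) f(2)] cmp_in[OF k(2) g(2)]]])
    next
      case (add k k')
      then show ?case
        by (simp add: tmor_add_right[OF h(2)] cmp_add_right[OF _ _ g(2)]
            cmp_add_right[OF tmor_in[OF h(2)] tmor_in[OF h(2)] tmor_in[OF f(2) g(2)]]
            tmor_add_right[OF cmp_in[OF h(2) f(2)] cmp_in[OF _ g(2)] cmp_in[OF _ g(2)]])
    qed
  next
    case (add f f')
    note k = \<open>k \<in> Hom C a' b'\<close>
    from add show ?case
      by (simp add: tmor_add_left[OF _ _ g(2)] cmp_add_left[OF h(2)]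
          cmp_add_left[OF tmor_in[OF h(2) k] tmor_in[OF _ g(2)] tmor_in[OF _ g(2)]]
          tmor_add_left[OF cmp_in[OF h(2)] cmp_in[OF h(2)] cmp_in[OF k g(2)]])
  qed
next
  case (add h h')
  note g = HomD_Hom[OF assms(4)]
  from add show ?case
    by (simp add: tmor_add_left[of _ a b _ _ a' b'] cmp_add_right[of _ a b _ _ c]
        cmp_add_right[OF tmor_in tmor_in tmor_in[OF _ g]]
        tmor_add_left[OF cmp_in cmp_in cmp_in[OF _ g]])
qed

text \<open>As for \<open>interchange_left\<close>; the scalar is now trivial because its second
  argument, the degree of \<open>h\<close>, is zero.\<close>

lemma interchange_right:
  assumes "h \<in> HomD C a b 0" "f \<in> Hom C b c" "k \<in> Hom C a' b'" "g \<in> Hom C b' c'"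
  shows "(f \<otimes> g) \<cdot> (h \<otimes> k) = (f \<cdot> h) \<otimes> (g \<cdot> k)"
  using assms(2-4)
proof (induction f rule: Hom_induct)
  case (homogeneous u f)
  note h = assms(1) HomD_Hom[OF assms(1)] and f = homogeneous(1) HomD_Hom[OF homogeneous(1)]
  from homogeneous(2,3) show ?case
  proof (induction k rule: Hom_induct)
    case (homogeneous z k)
    note k = homogeneous(1) HomD_Hom[OF homogeneous(1)]
    from homogeneous(2) show ?case
    proof (induction g rule: Hom_induct)
      case (homogeneous v g)
      note g = homogeneous(1) HomD_Hom[OF homogeneous(1)]
      show ?case
        using interchange[OF h(1) f(1) k(1) g(1)]
        by (simp add: scale_one[OF tmor_in[OF cmp_in[OF h(2) f(2)] cmp_in[OF k(2) g(2)]]])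
    next
      case (add g g')
      then show ?case
        by (simp add: tmor_add_right[OF f(2)] cmp_add_left[OF k(2)]
            cmp_add_left[OF tmor_in[OF h(2) k(2)] tmor_in[OF f(2)] tmor_in[OF f(2)]]
            tmor_add_right[OF cmp_in[OF h(2) f(2)] cmp_in[OF k(2)] cmp_in[OF k(2)]])
    qed
  next
    case (add k k')
    note g = \<open>g \<in> Hom C b' c'\<close>
    from add show ?case
      by (simp add: tmor_add_right[OF h(2)] cmp_add_right[OF _ _ g]
          cmp_add_right[OF tmor_in[OF h(2)] tmor_in[OF h(2)] tmor_in[OF f(2) g]]
          tmor_add_right[OF cmp_in[OF h(2) f(2)] cmp_in[OF _ g] cmp_in[OF _ g]])
  qed
next
  case (add f f')
  note h = HomD_Hom[OF assms(1)]
  from add show ?case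
    by (simp add: tmor_add_left[of _ b c _ _ b' c'] cmp_add_left[OF h]
        cmp_add_left[OF tmor_in[OF h] tmor_in tmor_in]
        tmor_add_left[OF cmp_in[OF h] cmp_in[OF h] cmp_in])
qed

text \<open>Here \<gamma> is the degree of the point of the fixed right factor, and
  \<open>g\<close>, \<open>g'\<close> are those of source and target. The prefactor turns the twist
  by the degree into a twist by the normalized degree.\<close>

definition tensor_right :: "'g \<Rightarrow> 'g \<Rightarrow> 'g \<Rightarrow> 'o \<Rightarrow> 'o \<Rightarrow> 'o \<Rightarrow> 'm \<Rightarrow> 'm" where
  "tensor_right \<gamma> g g' a b c f = scale C (\<mu> \<gamma> (g - g')) (twist (\<mu> \<gamma>) a b f \<otimes> idm C c)"

text \<open>\<open>x\<close> is reserved for the Koszul sign. The twist uses the plain degree, in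
  agreement with the coefficient in the last directions of \<open>tensor\<close>.\<close>

definition tensor_left :: "'k \<Rightarrow> 'g \<Rightarrow> 'o \<Rightarrow> 'o \<Rightarrow> 'o \<Rightarrow> 'm \<Rightarrow> 'm" where
  "tensor_left x g c d a f = scale C x (idm C a \<otimes> twist (\<mu> g) c d f)"

lemma tensor_right_Hom: "f \<in> Hom C a b \<Longrightarrow> tensor_right \<gamma> g g' a b c f \<in> Hom C (a \<odot> c) (b \<odot> c)"
  by (simp add: tensor_right_def tmor_in id_in)

lemma tensor_left_Hom: "f \<in> Hom C c d \<Longrightarrow> tensor_left x g c d a f \<in> Hom C (a \<odot> c) (a \<odot> d)"
  by (simp add: tensor_left_def tmor_in id_in)

lemma tensor_right_zero [simp]: "tensor_right \<gamma> g g' a b c 0 = 0"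
  by (simp add: tensor_right_def tmor_zero(1)[OF id_in])

lemma tensor_left_zero [simp]: "tensor_left x g c d a 0 = 0"
  by (simp add: tensor_left_def tmor_zero(2)[OF id_in])

lemma tensor_right_add:
  assumes "f \<in> Hom C a b" "f' \<in> Hom C a b"
  shows "tensor_right \<gamma> g g' a b c (f + f') = tensor_right \<gamma> g g' a b c f + tensor_right \<gamma> g g' a b c f'"
  by (simp add: tensor_right_def twist_add[OF assms]
      tmor_add_left[OF twist_Hom[OF assms(1)] twist_Hom[OF assms(2)] id_in]
      scale_add[OF tmor_in[OF twist_Hom[OF assms(1)] id_in] tmor_in[OF twist_Hom[OF assms(2)] id_in]])

lemma tensor_left_add:
  assumes "f \<in> Hom C c d" "f' \<in> Hom C c d"
  shows "tensor_left x g c d a (f + f') = tensor_left x g c d a f + tensor_left x g c d a f'"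
  by (simp add: tensor_left_def twist_add[OF assms]
      tmor_add_right[OF id_in twist_Hom[OF assms(1)] twist_Hom[OF assms(2)]]
      scale_add[OF tmor_in[OF id_in twist_Hom[OF assms(1)]] tmor_in[OF id_in twist_Hom[OF assms(2)]]])

lemma tensor_right_sum:
  "(\<And>i. i \<in> S \<Longrightarrow> f i \<in> Hom C a b) \<Longrightarrow>
    tensor_right \<gamma> g g' a b c (sum f S) = (\<Sum>i\<in>S. tensor_right \<gamma> g g' a b c (f i))"
  by (induction S rule: infinite_finite_induct) (simp_all add: tensor_right_add sum_Hom)

lemma tensor_left_sum:
  "(\<And>i. i \<in> S \<Longrightarrow> f i \<in> Hom C c d) \<Longrightarrow>
    tensor_left x g c d a (sum f S) = (\<Sum>i\<in>S. tensor_left x g c d a (f i))"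
  by (induction S rule: infinite_finite_induct) (simp_all add: tensor_left_add sum_Hom)

text \<open>The prefactors telescope, twisting is multiplicative, and identities have degree zero,
  so interchange adds no scalar.\<close>

lemma tensor_right_cmp:
  assumes f: "f \<in> Hom C a b" and f': "f' \<in> Hom C b d"
  shows "tensor_right \<gamma> g' g'' b d c f' \<cdot> tensor_right \<gamma> g g' a b c f = tensor_right \<gamma> g g'' a d c (f' \<cdot> f)"
proof -
  note t = twist_Hom[OF f, of "\<mu> \<gamma>"] twist_Hom[OF f', of "\<mu> \<gamma>"]
  note t1 = tmor_in[OF t(1) id_in, of c] tmor_in[OF t(2) id_in, of c]
  have "\<mu> \<gamma> (g' - g'') * \<mu> \<gamma> (g - g') = \<mu> \<gamma> (g - g'')"
    by (simp flip: mu_add_right)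
  then show ?thesis
    using interchange_left[OF t id_in id_degree_zero, of c]
    by (simp add: tensor_right_def cmp_scale_left[OF scale_Hom[OF t1(1)] t1(2)] cmp_scale_right[OF t1]
        scale_scale[OF cmp_in[OF t1]] twist_cmp[OF mu_add_right f f'] cmp_id[OF id_in])
      (simp add: scale_scale[OF tmor_in[OF cmp_in[OF t] id_in]])
qed

lemma tensor_left_cmp:
  assumes f: "f \<in> Hom C c d" and f': "f' \<in> Hom C d e"
  shows "tensor_left x' g d e a f' \<cdot> tensor_left x g c d a f = tensor_left (x' * x) g c e a (f' \<cdot> f)"
proof -
  note t = twist_Hom[OF f, of "\<mu> g"] twist_Hom[OF f', of "\<mu> g"]
  note t1 = tmor_in[OF id_in t(1), of a] tmor_in[OF id_in t(2), of a]
  show ?thesis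
    using interchange_right[OF id_degree_zero id_in t, of a]
    by (simp add: tensor_left_def cmp_scale_left[OF scale_Hom[OF t1(1)] t1(2)] cmp_scale_right[OF t1]
        scale_scale[OF cmp_in[OF t1]] twist_cmp[OF mu_add_right f f'] cmp_id[OF id_in])
      (simp add: scale_scale[OF tmor_in[OF id_in cmp_in[OF t]]])
qed

lemma tensor_right_homogeneous:
  assumes f: "f \<in> HomD C a b u"
  shows "tensor_right \<gamma> g g' a b c f = scale C (\<mu> \<gamma> (u + g - g')) (f \<otimes> idm C c)"
  by (simp add: tensor_right_def twist_homogeneous[OF f] tmor_scale_left[OF HomD_Hom[OF f] id_in]
      scale_scale[OF tmor_in[OF HomD_Hom[OF f] id_in]] algebra_simps flip: mu_add_right)

lemma tensor_left_homogeneous: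
  assumes f: "f \<in> HomD C c d u"
  shows "tensor_left x g c d a f = scale C (x * \<mu> g u) (idm C a \<otimes> f)"
  by (simp add: tensor_left_def twist_homogeneous[OF f] tmor_scale_right[OF id_in HomD_Hom[OF f]]
      scale_scale[OF tmor_in[OF id_in HomD_Hom[OF f]]])

lemma tensor_right_id: "tensor_right \<gamma> g g a a c (idm C a) = idm C (a \<odot> c)"
  by (simp add: tensor_right_homogeneous[OF id_degree_zero] tmor_id scale_one[OF id_in])

lemma tensor_left_id: "tensor_left 1 g c c a (idm C c) = idm C (a \<odot> c)"
  by (simp add: tensor_left_homogeneous[OF id_degree_zero] tmor_id scale_one[OF id_in])

text \<open>Both composites are multiples of \<open>f \<otimes> h\<close>. Only in the first does
  \<open>h\<close> have to pass \<open>f\<close>, which produces the extra factor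
  \<open>\<mu> v u\<close>.\<close>

lemma tensor_left_right_homogeneous:
  assumes f: "f \<in> HomD C a b u" and h: "h \<in> HomD C c d v"
  shows "tensor_left x g' c d b h \<cdot> tensor_right \<gamma> g g' a b c f =
      scale C (x * \<mu> g' v * \<mu> \<gamma> (u + g - g') * \<mu> v u) (f \<otimes> h)"
    and "tensor_right \<gamma>' g g' a b d f \<cdot> tensor_left x g c d a h =
      scale C (\<mu> \<gamma>' (u + g - g') * x * \<mu> g v) (f \<otimes> h)"
proof -
  note fH = HomD_Hom[OF f] and hH = HomD_Hom[OF h]
  note r = tmor_in[OF fH id_in, of c] and l = tmor_in[OF id_in hH, of b]
  show "tensor_left x g' c d b h \<cdot> tensor_right \<gamma> g g' a b c f =
      scale C (x * \<mu> g' v * \<mu> \<gamma> (u + g - g') * \<mu> v u) (f \<otimes> h)"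
    using interchange[OF f id_degree_zero id_degree_zero h]
    by (simp add: tensor_right_homogeneous[OF f] tensor_left_homogeneous[OF h]
        cmp_scale_left[OF scale_Hom[OF r] l] cmp_scale_right[OF r l] scale_scale[OF cmp_in[OF r l]]
        id_cmp[OF fH] cmp_id[OF hH])
      (simp add: scale_scale[OF tmor_in[OF fH hH]] mult.assoc)
  note l = tmor_in[OF id_in hH, of a] and r = tmor_in[OF fH id_in, of d]
  show "tensor_right \<gamma>' g g' a b d f \<cdot> tensor_left x g c d a h =
      scale C (\<mu> \<gamma>' (u + g - g') * x * \<mu> g v) (f \<otimes> h)"
    using interchange_left[OF id_in fH hH id_degree_zero]
    by (simp add: tensor_right_homogeneous[OF f] tensor_left_homogeneous[OF h]
        cmp_scale_left[OF scale_Hom[OF l] r] cmp_scale_right[OF l r] scale_scale[OF cmp_in[OF l r]]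
        cmp_id[OF fH] id_cmp[OF hH])
      (simp add: scale_scale[OF tmor_in[OF fH hH]] mult.assoc)
qed

end

section \<open>Commuting left and right tensoring for symmetric \<mu>\<close>

locale symmetric_graded_monoidal_category = graded_monoidal_category \<mu> C
  for \<mu> :: "'g::ab_group_add \<Rightarrow> 'g \<Rightarrow> 'k::{comm_ring, comm_monoid_mult}"
    and C :: "('k, 'g, 'o, 'm::ab_group_add) gmcat" (structure) +
  assumes symmetric: "\<mu> g h * \<mu> h g = 1"
begin

text \<open>Both sides are inverse to \<open>\<mu> h g\<close>, the right one by symmetry. Negating
  an argument thus serves as inversion.\<close>

lemma mu_swap: "\<mu> h (- g) = \<mu> g h"
proof -
  have "\<mu> h (- g) = (\<mu> g h * \<mu> h g) * \<mu> h (- g)" by (simp add: symmetric)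
  also have "\<dots> = \<mu> g h * \<mu> h (g + - g)" by (simp only: mu_add_right mult.assoc)
  finally show ?thesis by simp
qed

text \<open>The normalized degrees of \<open>f\<close> and \<open>h\<close> are \<open>u + g - g'\<close> and \<open>v + \<gamma> - \<gamma>'\<close>; the two composites
  differ by the value of \<open>\<mu>\<close> on these.\<close>

lemma normalized_scalar:
  assumes "u = g' - g \<or> v = \<gamma>' - \<gamma>"
  shows "\<mu> g' v * \<mu> \<gamma> (u + g - g') * \<mu> v u = \<mu> \<gamma>' (u + g - g') * \<mu> g v"
  using assms
proof
  \<comment> \<open>The normalized degree of \<open>f\<close> is zero, so the factors with \<gamma>
    and \<gamma>' are \<open>1\<close>. Symmetry cancels \<open>\<mu> g' v\<close> against
    \<open>\<mu> v g'\<close> and leaves \<open>\<mu> v (- g)\<close>, which is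
    \<open>\<mu> g v\<close>.\<close>
  assume u: "u = g' - g"
  have "\<mu> g' v * \<mu> v (g' + - g) = (\<mu> g' v * \<mu> v g') * \<mu> v (- g)"
    by (simp only: mu_add_right mult.assoc)
  then show ?thesis by (simp add: u symmetric mu_swap)
next
  assume v: "v = \<gamma>' - \<gamma>"
  then have "\<gamma>' = \<gamma> + v" by simp
  \<comment> \<open>This is the factor gained when \<gamma> is replaced by
    \<open>\<gamma> + v\<close>. It supplies the interchange scalar \<open>\<mu> v u\<close> and the
    coefficient \<open>\<mu> g' v\<close>, and its part \<open>\<mu> v g\<close> cancels
    \<open>\<mu> g v\<close>.\<close>
  moreover have "\<mu> v (u + g - g') = \<mu> v u * \<mu> v g * \<mu> g' v"
    using mu_add_right[of v "u + g" "- g'"] by (simp add: mu_add_right mu_swap)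
  ultimately have "\<mu> \<gamma>' (u + g - g') * \<mu> g v =
      \<mu> \<gamma> (u + g - g') * (\<mu> v u * \<mu> v g * \<mu> g' v) * \<mu> g v"
    by (simp add: mu_add_left)
  also have "\<dots> = \<mu> \<gamma> (u + g - g') * \<mu> v u * \<mu> g' v * (\<mu> v g * \<mu> g v)"
    by (simp only: ac_simps)
  also have "\<dots> = \<mu> g' v * \<mu> \<gamma> (u + g - g') * \<mu> v u"
    by (simp only: symmetric) (simp add: ac_simps)
  finally show ?thesis by simp
qed

text \<open>Both sides are additive in \<open>f\<close> and in \<open>h\<close>, so only the factor
  of normalized degree zero has to be homogeneous. The scalar \<open>y\<close> will be the Koszul
  sign of the exchange.\<close>

lemma tensor_left_right:
  assumes "f \<in> Hom C a b" "h \<in> Hom C c d"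
    and "f \<in> HomD C a b (g' - g) \<or> h \<in> HomD C c d (\<gamma>' - \<gamma>)"
  shows "tensor_left (y * x) g' c d b h \<cdot> tensor_right \<gamma> g g' a b c f =
      scale C y (tensor_right \<gamma>' g g' a b d f \<cdot> tensor_left x g c d a h)"
proof -
  have *: "tensor_left (y * x) g' c d b h \<cdot> tensor_right \<gamma> g g' a b c f =
      scale C y (tensor_right \<gamma>' g g' a b d f \<cdot> tensor_left x g c d a h)"
    if f: "f \<in> HomD C a b u" and h: "h \<in> HomD C c d v" and uv: "u = g' - g \<or> v = \<gamma>' - \<gamma>" for f h u v
  proof -
    have "y * x * \<mu> g' v * \<mu> \<gamma> (u + g - g') * \<mu> v u =
        y * x * (\<mu> g' v * \<mu> \<gamma> (u + g - g') * \<mu> v u)"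
      by (simp only: ac_simps)
    also have "\<dots> = y * (\<mu> \<gamma>' (u + g - g') * x * \<mu> g v)"
      unfolding normalized_scalar[OF uv] by (simp only: ac_simps)
    finally show ?thesis
      by (simp add: tensor_left_right_homogeneous[OF f h]
          scale_scale[OF tmor_in[OF HomD_Hom[OF f] HomD_Hom[OF h]]])
  qed
  from assms(3) show ?thesis
  proof
    assume f: "f \<in> HomD C a b (g' - g)"
    note fH = HomD_Hom[OF f]
    from assms(2) show ?thesis
    proof (induction h rule: Hom_induct)
      case (homogeneous v h)
      then show ?case using * f by blast
    next
      case (add h h')
      note r = tensor_right_Hom[OF fH] and l = tensor_left_Hom[OF add.hyps(1)] tensor_left_Hom[OF add.hyps(2)]
      show ?case
        by (simp add: tensor_left_add[OF add.hyps] cmp_add_left[OF r l] cmp_add_right[OF l r]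
            scale_add[OF cmp_in[OF l(1) r] cmp_in[OF l(2) r]] add.IH)
    qed
  next
    assume h: "h \<in> HomD C c d (\<gamma>' - \<gamma>)"
    note hH = HomD_Hom[OF h]
    from assms(1) show ?thesis
    proof (induction f rule: Hom_induct)
      case (homogeneous u f)
      then show ?case using * h by blast
    next
      case (add f f')
      note l = tensor_left_Hom[OF hH] and r = tensor_right_Hom[OF add.hyps(1)] tensor_right_Hom[OF add.hyps(2)]
      show ?case
        by (simp add: tensor_right_add[OF add.hyps] cmp_add_left[OF l r] cmp_add_right[OF r l]
            scale_add[OF cmp_in[OF l r(1)] cmp_in[OF l r(2)]] add.IH)
    qed
  qed
qed

end

section \<open>Tensoring matrices with identities\<close>

context graded_monoidal_category
begin

lemma total_obj_tensor: "total_obj (tensor \<mu> C A K) =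
    (lattice (pdim A + pdim K), \<lambda>p. pobj A (take (pdim A) p) \<odot> pobj K (drop (pdim A) p))"
  by (simp add: total_obj_def tensor_def Let_def)

text \<open>The matrix of \<open>F\<close> tensored with the identity of \<open>K\<close>. There is
  no sign, since a map on the first factor passes nothing on its left.\<close>

definition mat_right :: "('g, 'o, 'm) polycomplex \<Rightarrow> ('g, 'o, 'm) polycomplex \<Rightarrow> ('g, 'o, 'm) polycomplex \<Rightarrow>
    (int list \<Rightarrow> int list \<Rightarrow> 'm) \<Rightarrow> int list \<Rightarrow> int list \<Rightarrow> 'm" where
  "mat_right K A B F p' p =
     (let r = take (pdim A) p; q = drop (pdim A) p; r' = take (pdim B) p'; q' = drop (pdim B) p' in
      if p \<in> lattice (pdim A + pdim K) \<and> p' \<in> lattice (pdim B + pdim K) \<and> q = q'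
      then tensor_right (total_deg K q) (total_deg A r) (total_deg B r') (pobj A r) (pobj B r') (pobj K q) (F r' r)
      else 0)"

text \<open>The sign comes from moving a matrix of degree \<open>k\<close> past the factor \<open>A\<^sup>r\<close>.\<close>

definition mat_left :: "int \<Rightarrow> ('g, 'o, 'm) polycomplex \<Rightarrow> ('g, 'o, 'm) polycomplex \<Rightarrow> ('g, 'o, 'm) polycomplex \<Rightarrow>
    (int list \<Rightarrow> int list \<Rightarrow> 'm) \<Rightarrow> int list \<Rightarrow> int list \<Rightarrow> 'm" where
  "mat_left k A K L G p' p =
     (let r = take (pdim A) p; q = drop (pdim A) p; r' = take (pdim A) p'; q' = drop (pdim A) p' in
      if p \<in> lattice (pdim A + pdim K) \<and> p' \<in> lattice (pdim A + pdim L) \<and> r = r'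
      then tensor_left (koszul_sign (k * sum_list r)) (total_deg A r) (pobj K q) (pobj L q') (pobj A r) (G q' q)
      else 0)"

lemma mat_right_outside:
  assumes "\<not> (p \<in> lattice (pdim A + pdim K) \<and> p' \<in> lattice (pdim B + pdim K) \<and>
    drop (pdim A) p = drop (pdim B) p')"
  shows "mat_right K A B F p' p = 0"
  using assms unfolding mat_right_def Let_def by (rule if_not_P)

lemma mat_left_outside:
  assumes "\<not> (p \<in> lattice (pdim A + pdim K) \<and> p' \<in> lattice (pdim A + pdim L) \<and>
    take (pdim A) p = take (pdim A) p')"
  shows "mat_left k A K L G p' p = 0"
  using assms unfolding mat_left_def Let_def by (rule if_not_P)

lemma mat_right_append:
  assumes "r \<in> lattice (pdim A)" "q \<in> lattice (pdim K)" "r' \<in> lattice (pdim B)" "q' \<in> lattice (pdim K)"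
  shows "mat_right K A B F (r' @ q') (r @ q) =
    (if q = q' then tensor_right (total_deg K q) (total_deg A r) (total_deg B r')
        (pobj A r) (pobj B r') (pobj K q) (F r' r) else 0)"
  using assms lattice_append[OF assms(1,2)] lattice_append[OF assms(3,4)]
  by (simp add: mat_right_def lattice_def)

lemma mat_left_append:
  assumes "r \<in> lattice (pdim A)" "q \<in> lattice (pdim K)" "r' \<in> lattice (pdim A)" "q' \<in> lattice (pdim L)"
  shows "mat_left k A K L G (r' @ q') (r @ q) =
    (if r = r' then tensor_left (koszul_sign (k * sum_list r)) (total_deg A r)
        (pobj K q) (pobj L q') (pobj A r) (G q' q) else 0)"
  using assms lattice_append[OF assms(1,2)] lattice_append[OF assms(3,4)]
  by (simp add: mat_left_def lattice_def)

lemma mat_right_nonzero: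
  assumes "mat_right K A B F p' p \<noteq> 0"
  obtains r r' q where "p = r @ q" "p' = r' @ q" "r \<in> lattice (pdim A)" "r' \<in> lattice (pdim B)"
    "q \<in> lattice (pdim K)" "F r' r \<noteq> 0"
proof -
  have "p \<in> lattice (pdim A + pdim K)" "p' \<in> lattice (pdim B + pdim K)"
    using assms by (auto simp: mat_right_def Let_def split: if_splits)
  then obtain r q r' q' where *: "p = r @ q" "r \<in> lattice (pdim A)" "q \<in> lattice (pdim K)"
    "p' = r' @ q'" "r' \<in> lattice (pdim B)" "q' \<in> lattice (pdim K)"
    by (meson lattice_appendE)
  then have "q = q' \<and> F r' r \<noteq> 0"
    using assms by (auto simp: mat_right_append split: if_splits)
  with * show ?thesis by (auto intro: that)
qed

lemma mat_left_nonzero: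
  assumes "mat_left k A K L G p' p \<noteq> 0"
  obtains r q q' where "p = r @ q" "p' = r @ q'" "r \<in> lattice (pdim A)" "q \<in> lattice (pdim K)"
    "q' \<in> lattice (pdim L)" "G q' q \<noteq> 0"
proof -
  have "p \<in> lattice (pdim A + pdim K)" "p' \<in> lattice (pdim A + pdim L)"
    using assms by (auto simp: mat_left_def Let_def split: if_splits)
  then obtain r q r' q' where *: "p = r @ q" "r \<in> lattice (pdim A)" "q \<in> lattice (pdim K)"
    "p' = r' @ q'" "r' \<in> lattice (pdim A)" "q' \<in> lattice (pdim L)"
    by (meson lattice_appendE)
  then have "r = r' \<and> G q' q \<noteq> 0"
    using assms by (auto simp: mat_left_append split: if_splits)
  with * show ?thesis by (auto intro: that)
qed

lemma total_hom_entry: "F \<in> deg_hom k (total_obj A) (total_obj B) \<Longrightarrow> F s r \<in> Hom C (pobj A r) (pobj B s)"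
  using sum_hom_entry[OF deg_hom_sum_hom, of F k "total_obj A" "total_obj B" s r]
  by (simp add: total_obj_def)

lemma total_hom_support: "F \<in> deg_hom k (total_obj A) (total_obj B) \<Longrightarrow> F s r \<noteq> 0 \<Longrightarrow>
    r \<in> lattice (pdim A) \<and> s \<in> lattice (pdim B)"
  using sum_hom_support[OF deg_hom_sum_hom, of F k "total_obj A" "total_obj B" s r]
  by (simp add: total_obj_def)

lemma mat_right_in:
  assumes F: "F \<in> deg_hom k (total_obj A) (total_obj B)"
  shows "mat_right K A B F \<in> deg_hom k (total_obj (tensor \<mu> C A K)) (total_obj (tensor \<mu> C B K))"
proof -
  have deg: "sum_list p' = sum_list p + k" if "mat_right K A B F p' p \<noteq> 0" for p' p
    using that by (rule mat_right_nonzero) (use deg_hom_degree[OF F] in simp)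
  have "mat_right K A B F \<in> sum_hom C (total_obj (tensor \<mu> C A K)) (total_obj (tensor \<mu> C B K))"
  proof (rule sum_homI)
    fix p p'
    show "mat_right K A B F p' p \<in>
        Hom C (snd (total_obj (tensor \<mu> C A K)) p) (snd (total_obj (tensor \<mu> C B K)) p')"
      using tensor_right_Hom[OF total_hom_entry[OF F]]
      by (simp add: mat_right_def Let_def total_obj_tensor)
    show "p \<in> fst (total_obj (tensor \<mu> C A K)) \<and> p' \<in> fst (total_obj (tensor \<mu> C B K))"
      if "mat_right K A B F p' p \<noteq> 0"
      using that by (rule mat_right_nonzero) (simp add: total_obj_tensor lattice_append)
  next
    fix p
    have "{p'. mat_right K A B F p' p \<noteq> 0} \<subseteq>
        (\<lambda>r'. r' @ drop (pdim A) p) ` {r'. F r' (take (pdim A) p) \<noteq> 0}"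
      by (auto elim!: mat_right_nonzero simp: lattice_def)
    then show "finite {p'. mat_right K A B F p' p \<noteq> 0}"
      by (rule finite_subset) (simp add: sum_hom_finite[OF deg_hom_sum_hom[OF F]])
  qed
  with deg show ?thesis by (simp add: deg_hom_def)
qed

lemma mat_left_in:
  assumes G: "G \<in> deg_hom k (total_obj K) (total_obj L)"
  shows "mat_left k' A K L G \<in> deg_hom k (total_obj (tensor \<mu> C A K)) (total_obj (tensor \<mu> C A L))"
proof -
  have deg: "sum_list p' = sum_list p + k" if "mat_left k' A K L G p' p \<noteq> 0" for p' p
    using that by (rule mat_left_nonzero) (use deg_hom_degree[OF G] in simp)
  have "mat_left k' A K L G \<in> sum_hom C (total_obj (tensor \<mu> C A K)) (total_obj (tensor \<mu> C A L))"
  proof (rule sum_homI)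
    fix p p'
    show "mat_left k' A K L G p' p \<in>
        Hom C (snd (total_obj (tensor \<mu> C A K)) p) (snd (total_obj (tensor \<mu> C A L)) p')"
      using tensor_left_Hom[OF total_hom_entry[OF G]]
      by (simp add: mat_left_def Let_def total_obj_tensor)
    show "p \<in> fst (total_obj (tensor \<mu> C A K)) \<and> p' \<in> fst (total_obj (tensor \<mu> C A L))"
      if "mat_left k' A K L G p' p \<noteq> 0"
      using that by (rule mat_left_nonzero) (simp add: total_obj_tensor lattice_append)
  next
    fix p
    have "{p'. mat_left k' A K L G p' p \<noteq> 0} \<subseteq>
        (\<lambda>q'. take (pdim A) p @ q') ` {q'. G q' (drop (pdim A) p) \<noteq> 0}"
      by (auto elim!: mat_left_nonzero simp: lattice_def)
    then show "finite {p'. mat_left k' A K L G p' p \<noteq> 0}"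
      by (rule finite_subset) (simp add: sum_hom_finite[OF deg_hom_sum_hom[OF G]])
  qed
  with deg show ?thesis by (simp add: deg_hom_def)
qed

lemma mat_right_add:
  assumes "F \<in> deg_hom k (total_obj A) (total_obj B)" "F' \<in> deg_hom k (total_obj A) (total_obj B)"
  shows "mat_right K A B (F + F') = mat_right K A B F + mat_right K A B F'"
  by (intro ext) (simp add: mat_right_def Let_def
      tensor_right_add[OF total_hom_entry[OF assms(1)] total_hom_entry[OF assms(2)]])

lemma mat_left_add:
  assumes "F \<in> deg_hom k (total_obj K) (total_obj L)" "F' \<in> deg_hom k (total_obj K) (total_obj L)"
  shows "mat_left k' A K L (F + F') = mat_left k' A K L F + mat_left k' A K L F'"
  by (intro ext) (simp add: mat_left_def Let_def
      tensor_left_add[OF total_hom_entry[OF assms(1)] total_hom_entry[OF assms(2)]])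

lemma mat_right_id:
  "mat_right K A A (sum_id C (total_obj A)) = sum_id C (total_obj (tensor \<mu> C A K))"
proof (intro ext)
  fix p' p
  show "mat_right K A A (sum_id C (total_obj A)) p' p = sum_id C (total_obj (tensor \<mu> C A K)) p' p"
  proof (cases "p \<in> lattice (pdim A + pdim K) \<and> p' \<in> lattice (pdim A + pdim K)")
    case True
    then obtain r q r' q' where *: "p = r @ q" "r \<in> lattice (pdim A)" "q \<in> lattice (pdim K)"
      "p' = r' @ q'" "r' \<in> lattice (pdim A)" "q' \<in> lattice (pdim K)"
      by (meson lattice_appendE)
    then have len: "length r = pdim A" "length r' = pdim A" by (simp_all add: lattice_def)
    have 1: "sum_id C (total_obj (tensor \<mu> C A K)) p' p =
        (if r = r' \<and> q = q' then idm C (pobj A r \<odot> pobj K q) else 0)"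
      using True len by (auto simp: * sum_id_def total_obj_tensor)
    have 2: "sum_id C (total_obj A) r' r = (if r = r' then idm C (pobj A r) else 0)"
      using * by (auto simp: sum_id_def total_obj_def)
    have 3: "mat_right K A A (sum_id C (total_obj A)) p' p =
        (if q = q' then tensor_right (total_deg K q) (total_deg A r) (total_deg A r')
        (pobj A r) (pobj A r') (pobj K q) (sum_id C (total_obj A) r' r) else 0)"
      unfolding *(1,4) by (rule mat_right_append[OF *(2,3,5,6)])
    show ?thesis unfolding 3 2 1 by (auto simp: tensor_right_id)
  next
    case False
    have "mat_right K A A (sum_id C (total_obj A)) p' p = 0"
      using False by (intro mat_right_outside) blast
    moreover have "sum_id C (total_obj (tensor \<mu> C A K)) p' p = 0"
      using False by (auto simp: sum_id_def total_obj_tensor)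
    ultimately show ?thesis by simp
  qed
qed

lemma mat_left_id:
  "mat_left 0 A K K (sum_id C (total_obj K)) = sum_id C (total_obj (tensor \<mu> C A K))"
proof (intro ext)
  fix p' p
  show "mat_left 0 A K K (sum_id C (total_obj K)) p' p = sum_id C (total_obj (tensor \<mu> C A K)) p' p"
  proof (cases "p \<in> lattice (pdim A + pdim K) \<and> p' \<in> lattice (pdim A + pdim K)")
    case True
    then obtain r q r' q' where *: "p = r @ q" "r \<in> lattice (pdim A)" "q \<in> lattice (pdim K)"
      "p' = r' @ q'" "r' \<in> lattice (pdim A)" "q' \<in> lattice (pdim K)"
      by (meson lattice_appendE)
    then have len: "length r = pdim A" "length r' = pdim A" by (simp_all add: lattice_def)
    have 1: "sum_id C (total_obj (tensor \<mu> C A K)) p' p =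
        (if r = r' \<and> q = q' then idm C (pobj A r \<odot> pobj K q) else 0)"
      using True len by (auto simp: * sum_id_def total_obj_tensor)
    have 2: "sum_id C (total_obj K) q' q = (if q = q' then idm C (pobj K q) else 0)"
      using * by (auto simp: sum_id_def total_obj_def)
    have 3: "mat_left 0 A K K (sum_id C (total_obj K)) p' p =
        (if r = r' then tensor_left (koszul_sign (0 * sum_list r)) (total_deg A r)
        (pobj K q) (pobj K q') (pobj A r) (sum_id C (total_obj K) q' q) else 0)"
      unfolding *(1,4) by (rule mat_left_append[OF *(2,3,5,6)])
    show ?thesis unfolding 3 2 1 by (auto simp: tensor_left_id)
  next
    case False
    have "mat_left 0 A K K (sum_id C (total_obj K)) p' p = 0"
      using False by (intro mat_left_outside) blast
    moreover have "sum_id C (total_obj (tensor \<mu> C A K)) p' p = 0"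
      using False by (auto simp: sum_id_def total_obj_tensor)
    ultimately show ?thesis by simp
  qed
qed

lemma mat_right_cmp:
  assumes F: "F \<in> deg_hom k (total_obj A) (total_obj B)" and G: "G \<in> deg_hom l (total_obj B) (total_obj D)"
  shows "sum_cmp C (mat_right K B D G) (mat_right K A B F) = mat_right K A D (sum_cmp C G F)"
proof (intro ext)
  fix p' p
  note inF = deg_hom_sum_hom[OF mat_right_in[OF F, of K]] and inG = deg_hom_sum_hom[OF mat_right_in[OF G, of K]]
  note entF = total_hom_entry[OF F] and entG = total_hom_entry[OF G]
  show "sum_cmp C (mat_right K B D G) (mat_right K A B F) p' p = mat_right K A D (sum_cmp C G F) p' p"
  proof (cases "p \<in> lattice (pdim A + pdim K) \<and> p' \<in> lattice (pdim D + pdim K) \<and>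
      drop (pdim A) p = drop (pdim D) p'")
    case False
    then have "mat_right K A D (sum_cmp C G F) p' p = 0" by (rule mat_right_outside)
    moreover have "sum_cmp C (mat_right K B D G) (mat_right K A B F) p' p = 0"
    proof (rule sum_cmp_eq_zero[OF inF inG])
      fix p'' assume "mat_right K A B F p'' p \<noteq> 0" "mat_right K B D G p' p'' \<noteq> 0"
      then show False using False
        by (auto elim!: mat_right_nonzero simp: lattice_def)
    qed
    ultimately show ?thesis by simp
  next
    case True
    then obtain r q r' q' where *: "p = r @ q" "r \<in> lattice (pdim A)" "q \<in> lattice (pdim K)"
      "p' = r' @ q'" "r' \<in> lattice (pdim D)" "q' \<in> lattice (pdim K)"
      by (meson lattice_appendE)
    then have [simp]: "q' = q" using True by (simp add: lattice_def)
    let ?S = "{s. F s r \<noteq> 0}"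
    have S: "s \<in> lattice (pdim B)" if "s \<in> ?S" for s using total_hom_support[OF F] that by blast
    have fin: "finite ?S" by (rule sum_hom_finite[OF deg_hom_sum_hom[OF F]])
    \<comment> \<open>All intermediate points share the coordinates \<open>q\<close>, so they are
      indexed by the support of column \<open>r\<close> of \<open>F\<close>.\<close>
    have "sum_cmp C (mat_right K B D G) (mat_right K A B F) p' p =
        (\<Sum>p''\<in>(\<lambda>s. s @ q) ` ?S. mat_right K B D G p' p'' \<cdot> mat_right K A B F p'' p)"
    proof (rule sum_cmp_eq[OF inF inG])
      fix p'' assume "mat_right K A B F p'' p \<noteq> 0"
      then show "p'' \<in> (\<lambda>s. s @ q) ` ?S" using * by (auto elim!: mat_right_nonzero simp: lattice_def)
    qed (use fin in simp)
    also have "\<dots> = (\<Sum>s\<in>?S. mat_right K B D G p' (s @ q) \<cdot> mat_right K A B F (s @ q) p)"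
      by (subst sum.reindex) (auto simp: inj_on_def)
    also have "\<dots> = (\<Sum>s\<in>?S. tensor_right (total_deg K q) (total_deg A r) (total_deg D r')
        (pobj A r) (pobj D r') (pobj K q) (G r' s \<cdot> F s r))"
      using * S by (intro sum.cong refl) (simp add: mat_right_append tensor_right_cmp[OF entF entG])
    also have "\<dots> = mat_right K A D (sum_cmp C G F) p' p"
      using * by (simp add: mat_right_append sum_cmp_def tensor_right_sum cmp_in[OF entF entG])
    finally show ?thesis .
  qed
qed

text \<open>The exponents of the Koszul signs add, which is why the degree is an explicit argument
  of \<open>mat_left\<close> and becomes \<open>k + l\<close> for the composite.\<close>

lemma mat_left_cmp:
  assumes F: "F \<in> deg_hom k (total_obj K) (total_obj L)" and G: "G \<in> deg_hom l (total_obj L) (total_obj M)"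
  shows "sum_cmp C (mat_left l A L M G) (mat_left k A K L F) = mat_left (k + l) A K M (sum_cmp C G F)"
proof (intro ext)
  fix p' p
  note inF = deg_hom_sum_hom[OF mat_left_in[OF F, of k A]] and inG = deg_hom_sum_hom[OF mat_left_in[OF G, of l A]]
  note entF = total_hom_entry[OF F] and entG = total_hom_entry[OF G]
  show "sum_cmp C (mat_left l A L M G) (mat_left k A K L F) p' p = mat_left (k + l) A K M (sum_cmp C G F) p' p"
  proof (cases "p \<in> lattice (pdim A + pdim K) \<and> p' \<in> lattice (pdim A + pdim M) \<and>
      take (pdim A) p = take (pdim A) p'")
    case False
    then have "mat_left (k + l) A K M (sum_cmp C G F) p' p = 0" by (rule mat_left_outside)
    moreover have "sum_cmp C (mat_left l A L M G) (mat_left k A K L F) p' p = 0"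
    proof (rule sum_cmp_eq_zero[OF inF inG])
      fix p'' assume "mat_left k A K L F p'' p \<noteq> 0" "mat_left l A L M G p' p'' \<noteq> 0"
      then show False using False
        by (auto elim!: mat_left_nonzero simp: lattice_def)
    qed
    ultimately show ?thesis by simp
  next
    case True
    then obtain r q r' q' where *: "p = r @ q" "r \<in> lattice (pdim A)" "q \<in> lattice (pdim K)"
      "p' = r' @ q'" "r' \<in> lattice (pdim A)" "q' \<in> lattice (pdim M)"
      by (meson lattice_appendE)
    then have [simp]: "r' = r" using True by (simp add: lattice_def)
    let ?S = "{s. F s q \<noteq> 0}"
    have S: "s \<in> lattice (pdim L)" if "s \<in> ?S" for s using total_hom_support[OF F] that by blast
    have fin: "finite ?S" by (rule sum_hom_finite[OF deg_hom_sum_hom[OF F]])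
    have sgn: "koszul_sign ((k + l) * sum_list r) =
        (koszul_sign (l * sum_list r) * koszul_sign (k * sum_list r) :: 'k)"
      unfolding koszul_sign_add[symmetric] by (simp add: algebra_simps)
    have "sum_cmp C (mat_left l A L M G) (mat_left k A K L F) p' p =
        (\<Sum>p''\<in>(\<lambda>s. r @ s) ` ?S. mat_left l A L M G p' p'' \<cdot> mat_left k A K L F p'' p)"
    proof (rule sum_cmp_eq[OF inF inG])
      fix p'' assume "mat_left k A K L F p'' p \<noteq> 0"
      then show "p'' \<in> (\<lambda>s. r @ s) ` ?S" using * by (auto elim!: mat_left_nonzero simp: lattice_def)
    qed (use fin in simp)
    also have "\<dots> = (\<Sum>s\<in>?S. mat_left l A L M G p' (r @ s) \<cdot> mat_left k A K L F (r @ s) p)"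
      by (subst sum.reindex) (auto simp: inj_on_def)
    also have "\<dots> = (\<Sum>s\<in>?S. tensor_left (koszul_sign ((k + l) * sum_list r)) (total_deg A r)
        (pobj K q) (pobj M q') (pobj A r) (G q' s \<cdot> F s q))"
      using * S by (intro sum.cong refl) (simp add: mat_left_append tensor_left_cmp[OF entF entG] sgn)
    also have "\<dots> = mat_left (k + l) A K M (sum_cmp C G F) p' p"
      using * by (simp add: mat_left_append sum_cmp_def tensor_left_sum cmp_in[OF entF entG])
    finally show ?thesis .
  qed
qed

text \<open>For the differential of \<open>A\<close> the normalized degree vanishes and
  \<open>tensor_right\<close> adds no scalar. For that of \<open>K\<close>, \<open>mat_left\<close>
  with degree \<open>1\<close> yields exactly the sign and coefficient in
  \<open>tensor\<close>.\<close>

lemma total_diff_tensor: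
  assumes A: "homogeneous_polycomplex C A" and K: "homogeneous_polycomplex C K"
  shows "total_diff (tensor \<mu> C A K) = mat_right K A A (total_diff A) + mat_left 1 A K K (total_diff K)"
proof (intro ext)
  fix p' p
  let ?n = "pdim A" and ?m = "pdim K" and ?T = "tensor \<mu> C A K"
  show "total_diff ?T p' p = (mat_right K A A (total_diff A) + mat_left 1 A K K (total_diff K)) p' p"
  proof (cases "p \<in> lattice (?n + ?m) \<and> p' \<in> lattice (?n + ?m)")
    case False
    have "total_diff ?T p' p = 0"
    proof (rule ccontr)
      assume "total_diff ?T p' p \<noteq> 0"
      then show False using False by (auto elim!: total_diff_nonzero simp: tensor_def Let_def)
    qed
    moreover have "mat_right K A A (total_diff A) p' p = 0"
      using False by (intro mat_right_outside) blast
    moreover have "mat_left 1 A K K (total_diff K) p' p = 0"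
      using False by (intro mat_left_outside) blast
    ultimately show ?thesis by simp
  next
    case True
    then obtain r q r' q' where *: "p = r @ q" "r \<in> lattice ?n" "q \<in> lattice ?m"
      "p' = r' @ q'" "r' \<in> lattice ?n" "q' \<in> lattice ?m"
      by (meson lattice_appendE)
    then have len: "length r = ?n" "length r' = ?n" by (simp_all add: lattice_def)
    have eq1: "p' = shift i p \<longleftrightarrow> r' = shift i r \<and> q' = q" if "i < ?n" for i
      using that len by (simp add: * shift_append1)
    have eq2: "p' = shift (?n + j) p \<longleftrightarrow> r' = r \<and> q' = shift j q" for j
      using len shift_append2[of r j q] by (simp add: *)
    have d1: "pdiff ?T i p = pdiff A i r \<otimes> idm C (pobj K q)" if "i < ?n" for i
      using that len by (simp add: tensor_def Let_def *)
    have d2: "pdiff ?T (?n + j) p = scale C (koszul_sign (sum_list r) * \<mu> (total_deg A r) (pcoc K j q))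
        (idm C (pobj A r) \<otimes> pdiff K j q)" for j
      using len by (simp add: tensor_def Let_def *)
    have dim: "pdim ?T = ?n + ?m" by (simp add: tensor_def Let_def)
    have split: "{i. i < ?n + ?m \<and> p' = shift i p} =
        {i. i < ?n \<and> p' = shift i p} \<union> (+) ?n ` {j. j < ?m \<and> p' = shift (?n + j) p}"
    proof (intro equalityI subsetI)
      fix i assume i: "i \<in> {i. i < ?n + ?m \<and> p' = shift i p}"
      show "i \<in> {i. i < ?n \<and> p' = shift i p} \<union> (+) ?n ` {j. j < ?m \<and> p' = shift (?n + j) p}"
      proof (cases "i < ?n")
        case False
        then have "i = ?n + (i - ?n)" "i - ?n < ?m" using i by auto
        then show ?thesis using i by (intro UnI2 image_eqI[of _ _ "i - ?n"]) auto
      qed (use i in simp)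
    next
      fix i assume "i \<in> {i. i < ?n \<and> p' = shift i p} \<union> (+) ?n ` {j. j < ?m \<and> p' = shift (?n + j) p}"
      then show "i \<in> {i. i < ?n + ?m \<and> p' = shift i p}"
        by (elim UnE imageE CollectE conjE) simp_all
    qed
    have "total_diff ?T p' p = (\<Sum>i | i < ?n + ?m \<and> p' = shift i p. pdiff ?T i p)"
      using True by (simp add: total_diff_def dim)
    also have "\<dots> = (\<Sum>i | i < ?n \<and> p' = shift i p. pdiff ?T i p) +
        (\<Sum>j | j < ?m \<and> p' = shift (?n + j) p. pdiff ?T (?n + j) p)"
      unfolding split by (subst sum.union_disjoint) (auto simp: sum.reindex)
    also have "(\<Sum>i | i < ?n \<and> p' = shift i p. pdiff ?T i p) = mat_right K A A (total_diff A) p' p"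
    proof (cases "\<exists>i<?n. p' = shift i p")
      case True
      then obtain i where i: "i < ?n" "r' = shift i r" "q' = q" using eq1 by auto
      have "{i. i < ?n \<and> p' = shift i p} = {i}"
        using i eq1 shift_eq_iff[of i r] len by auto
      moreover have f: "pdiff A i r \<in> HomD C (pobj A r) (pobj A (shift i r)) (pcoc A i r)"
        using A i(1) *(2) by (simp add: homogeneous_polycomplex_def)
      moreover have "total_deg A (shift i r) = total_deg A r + pcoc A i r"
        using A i(1) *(2) by (intro total_deg_shift) (simp_all add: homogeneous_polycomplex_def)
      moreover have "mat_right K A A (total_diff A) p' p =
          tensor_right (total_deg K q) (total_deg A r) (total_deg A (shift i r))
            (pobj A r) (pobj A (shift i r)) (pobj K q) (pdiff A i r)"
        using i * by (simp add: mat_right_append total_diff_shift)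
      ultimately show ?thesis
        by (simp add: d1[OF i(1)] tensor_right_homogeneous[OF f]
            scale_one[OF tmor_in[OF HomD_Hom[OF f] id_in]])
    next
      case False
      have "mat_right K A A (total_diff A) p' p = 0"
      proof (rule ccontr)
        assume "mat_right K A A (total_diff A) p' p \<noteq> 0"
        then have q: "q' = q" and "total_diff A r' r \<noteq> 0"
          using * by (auto simp: mat_right_append split: if_splits)
        from this(2) obtain i where "i < ?n" "r' = shift i r" by (rule total_diff_nonzero)
        then show False using False eq1 q by blast
      qed
      moreover have "{i. i < ?n \<and> p' = shift i p} = {}" using False by blast
      ultimately show ?thesis by (simp only: sum.empty)
    qed
    also have "(\<Sum>j | j < ?m \<and> p' = shift (?n + j) p. pdiff ?T (?n + j) p) =
        mat_left 1 A K K (total_diff K) p' p"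
    proof (cases "\<exists>j<?m. p' = shift (?n + j) p")
      case True
      then obtain j where j: "j < ?m" "r' = r" "q' = shift j q" using eq2 by auto
      have "{j. j < ?m \<and> p' = shift (?n + j) p} = {j}"
        using j eq2 shift_eq_iff[of j q] *(3) by (auto simp: lattice_def)
      moreover have f: "pdiff K j q \<in> HomD C (pobj K q) (pobj K (shift j q)) (pcoc K j q)"
        using K j(1) *(3) by (simp add: homogeneous_polycomplex_def)
      moreover have "mat_left 1 A K K (total_diff K) p' p =
          tensor_left (koszul_sign (sum_list r)) (total_deg A r)
            (pobj K q) (pobj K (shift j q)) (pobj A r) (pdiff K j q)"
        using j * by (simp add: mat_left_append total_diff_shift)
      ultimately show ?thesis
        by (simp add: d2 tensor_left_homogeneous[OF f])
    next
      case False
      have "mat_left 1 A K K (total_diff K) p' p = 0"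
      proof (rule ccontr)
        assume "mat_left 1 A K K (total_diff K) p' p \<noteq> 0"
        then have r: "r' = r" and "total_diff K q' q \<noteq> 0"
          using * by (auto simp: mat_left_append split: if_splits)
        from this(2) obtain j where "j < ?m" "q' = shift j q" by (rule total_diff_nonzero)
        then show False using False eq2 r by blast
      qed
      moreover have "{j. j < ?m \<and> p' = shift (?n + j) p} = {}" using False by blast
      ultimately show ?thesis by (simp only: sum.empty)
    qed
    finally show ?thesis by simp
  qed
qed

text \<open>Covers tensoring on either side: \<open>T\<close> acts on maps of the varying factor,
  and \<open>R\<close> is the differential of the fixed one. Graded commutation lets
  \<open>R\<close> pass chain maps and kills the cross terms in the square of the differential and
  in the homotopy relation.\<close>

lemma equivalent_functor:
  assumes eq: "equivalent (Ob a) D (Ob b) E"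
    and T_in: "\<And>x y k F. F \<in> deg_hom k (Ob x) (Ob y) \<Longrightarrow> T k x y F \<in> deg_hom k (Ob' x) (Ob' y)"
    and T_add: "\<And>x y k F F'. F \<in> deg_hom k (Ob x) (Ob y) \<Longrightarrow> F' \<in> deg_hom k (Ob x) (Ob y) \<Longrightarrow>
      T k x y (F + F') = T k x y F + T k x y F'"
    and T_cmp: "\<And>x y z k l F G. F \<in> deg_hom k (Ob x) (Ob y) \<Longrightarrow> G \<in> deg_hom l (Ob y) (Ob z) \<Longrightarrow>
      sum_cmp C (T l y z G) (T k x y F) = T (k + l) x z (sum_cmp C G F)"
    and T_id: "\<And>x. T 0 x x (sum_id C (Ob x)) = sum_id C (Ob' x)"
    and R_in: "\<And>x. R x \<in> deg_hom 1 (Ob' x) (Ob' x)"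
    and R_square: "\<And>x. sum_cmp C (R x) (R x) = 0"
    and R_even: "\<And>x y F. F \<in> deg_hom 0 (Ob x) (Ob y) \<Longrightarrow>
      sum_cmp C (R y) (T 0 x y F) = sum_cmp C (T 0 x y F) (R x)"
    and R_odd: "\<And>x y k F. odd k \<Longrightarrow> F \<in> deg_hom k (Ob x) (Ob y) \<Longrightarrow>
      sum_cmp C (R y) (T k x y F) + sum_cmp C (T k x y F) (R x) = 0"
  shows "equivalent (Ob' a) (T 1 a a D + R a) (Ob' b) (T 1 b b E + R b)"
proof -
  note s = deg_hom_sum_hom
  have T_zero: "T k x y 0 = 0" for k x y
    using T_add[of 0 k x y 0] by (simp add: deg_hom_def)
  have square: "sum_cmp C (T 1 x x d + R x) (T 1 x x d + R x) = 0"
    if d: "d \<in> deg_hom 1 (Ob x) (Ob x)" "sum_cmp C d d = 0" for x d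
  proof -
    note t = s[OF T_in[OF d(1)]] and r = s[OF R_in[of x]]
    have "sum_cmp C (T 1 x x d + R x) (T 1 x x d + R x) =
        sum_cmp C (T 1 x x d) (T 1 x x d) + sum_cmp C (R x) (R x) +
        (sum_cmp C (R x) (T 1 x x d) + sum_cmp C (T 1 x x d) (R x))"
      by (simp add: sum_cmp_add_left[OF add_sum_hom[OF t r] t r] sum_cmp_add_right[OF t r t]
          sum_cmp_add_right[OF t r r])
    then show ?thesis by (simp add: R_odd[OF _ d(1)] R_square T_cmp[OF d(1) d(1)] d(2) T_zero)
  qed
  have chain: "sum_cmp C (T 1 y y e + R y) (T 0 x y F) = sum_cmp C (T 0 x y F) (T 1 x x d + R x)"
    if F: "F \<in> deg_hom 0 (Ob x) (Ob y)" and d: "d \<in> deg_hom 1 (Ob x) (Ob x)"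
      and e: "e \<in> deg_hom 1 (Ob y) (Ob y)" and ef: "sum_cmp C e F = sum_cmp C F d" for x y d e F
    by (simp add: sum_cmp_add_left[OF s[OF T_in[OF F]] s[OF T_in[OF e]] s[OF R_in]]
        sum_cmp_add_right[OF s[OF T_in[OF d]] s[OF R_in] s[OF T_in[OF F]]] T_cmp[OF F e] T_cmp[OF d F]
        ef R_even[OF F])
  have homotopy: "sum_cmp C (T 0 y x G) (T 0 x y F) = sum_id C (Ob' x) +
      (sum_cmp C (T 1 x x d + R x) (T (- 1) x x H) + sum_cmp C (T (- 1) x x H) (T 1 x x d + R x))"
    if F: "F \<in> deg_hom 0 (Ob x) (Ob y)" and G: "G \<in> deg_hom 0 (Ob y) (Ob x)"
      and d: "d \<in> deg_hom 1 (Ob x) (Ob x)" and H: "H \<in> deg_hom (- 1) (Ob x) (Ob x)"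
      and gf: "sum_cmp C G F = sum_id C (Ob x) + (sum_cmp C d H + sum_cmp C H d)" for x y d F G H
  proof -
    have dH: "sum_cmp C d H \<in> deg_hom 0 (Ob x) (Ob x)" "sum_cmp C H d \<in> deg_hom 0 (Ob x) (Ob x)"
      using deg_hom_cmp[OF H d] deg_hom_cmp[OF d H] by simp_all
    have "sum_cmp C (T 1 x x d + R x) (T (- 1) x x H) + sum_cmp C (T (- 1) x x H) (T 1 x x d + R x) =
        T 0 x x (sum_cmp C d H) + T 0 x x (sum_cmp C H d) +
        (sum_cmp C (R x) (T (- 1) x x H) + sum_cmp C (T (- 1) x x H) (R x))"
      using T_cmp[OF H d] T_cmp[OF d H]
      by (simp add: sum_cmp_add_left[OF s[OF T_in[OF H]] s[OF T_in[OF d]] s[OF R_in]]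
          sum_cmp_add_right[OF s[OF T_in[OF d]] s[OF R_in] s[OF T_in[OF H]]])
    \<comment> \<open>The homotopy has odd degree, so \<open>R\<close> contributes nothing and the
      image of \<open>H\<close> is again a homotopy.\<close>
    moreover have "sum_cmp C (R x) (T (- 1) x x H) + sum_cmp C (T (- 1) x x H) (R x) = 0"
      by (rule R_odd[OF _ H]) simp
    moreover have "sum_cmp C (T 0 y x G) (T 0 x y F) =
        sum_id C (Ob' x) + (T 0 x x (sum_cmp C d H) + T 0 x x (sum_cmp C H d))"
      using T_cmp[OF F G] by (simp add: gf T_add[OF deg_hom_id deg_hom_add[OF dH]] T_add[OF dH] T_id)
    ultimately show ?thesis by (simp only: add_0_right)
  qed
  obtain F G H K where D: "D \<in> deg_hom 1 (Ob a) (Ob a)" "sum_cmp C D D = 0"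
    and E: "E \<in> deg_hom 1 (Ob b) (Ob b)" "sum_cmp C E E = 0"
    and F: "F \<in> deg_hom 0 (Ob a) (Ob b)" and G: "G \<in> deg_hom 0 (Ob b) (Ob a)"
    and H: "H \<in> deg_hom (- 1) (Ob a) (Ob a)" and K: "K \<in> deg_hom (- 1) (Ob b) (Ob b)"
    and EF: "sum_cmp C E F = sum_cmp C F D" and DG: "sum_cmp C D G = sum_cmp C G E"
    and GF: "sum_cmp C G F = sum_id C (Ob a) + (sum_cmp C D H + sum_cmp C H D)"
    and FG: "sum_cmp C F G = sum_id C (Ob b) + (sum_cmp C E K + sum_cmp C K E)"
    using eq unfolding equivalent_def by (elim conjE exE)
  show ?thesis
    unfolding equivalent_def
    by (intro conjI exI[of _ "T 0 a b F"] exI[of _ "T 0 b a G"] exI[of _ "T (- 1) a a H"]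
        exI[of _ "T (- 1) b b K"] deg_hom_add T_in R_in D(1) E(1) F G H K square[OF D] square[OF E]
        chain[OF F D(1) E(1) EF] chain[OF G E(1) D(1) DG]
        homotopy[OF F G D(1) H GF] homotopy[OF G F E(1) K FG])
qed

end

section \<open>Graded commutation of matrices and invariance of the tensor product\<close>

context symmetric_graded_monoidal_category
begin

text \<open>Each composite passes through a single point, \<open>r' @ q\<close> on one side and
  \<open>r @ q'\<close> on the other, which reduces the claim to \<open>tensor_left_right\<close>
  for one pair of entries.\<close>

lemma mat_left_right:
  assumes F: "F \<in> deg_hom l (total_obj A) (total_obj B)" and G: "G \<in> deg_hom k (total_obj K) (total_obj L)"
    and hom: "homogeneous A B F \<or> homogeneous K L G"
  shows "sum_cmp C (mat_left k B K L G) (mat_right K A B F) p' p =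
    scale C (koszul_sign (k * l)) (sum_cmp C (mat_right L A B F) (mat_left k A K L G) p' p)"
proof -
  note inR = deg_hom_sum_hom[OF mat_right_in[OF F]] and inL = deg_hom_sum_hom[OF mat_left_in[OF G]]
  show ?thesis
  proof (cases "p \<in> lattice (pdim A + pdim K) \<and> p' \<in> lattice (pdim B + pdim L)")
    case False
    have "sum_cmp C (mat_left k B K L G) (mat_right K A B F) p' p = 0"
      using False by (intro sum_cmp_eq_zero[OF inR inL])
        (auto elim!: mat_left_nonzero mat_right_nonzero simp: lattice_append)
    moreover have "sum_cmp C (mat_right L A B F) (mat_left k A K L G) p' p = 0"
      using False by (intro sum_cmp_eq_zero[OF inL inR])
        (auto elim!: mat_left_nonzero mat_right_nonzero simp: lattice_append)
    ultimately show ?thesis by simp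
  next
    case True
    then obtain r q r' q' where *: "p = r @ q" "r \<in> lattice (pdim A)" "q \<in> lattice (pdim K)"
      "p' = r' @ q'" "r' \<in> lattice (pdim B)" "q' \<in> lattice (pdim L)"
      by (meson lattice_appendE)
    have "sum_cmp C (mat_left k B K L G) (mat_right K A B F) p' p =
        mat_left k B K L G p' (r' @ q) \<cdot> mat_right K A B F (r' @ q) p"
      using * by (intro sum_cmp_single[OF inR inL])
        (auto elim!: mat_left_nonzero mat_right_nonzero simp: lattice_def)
    moreover have "sum_cmp C (mat_right L A B F) (mat_left k A K L G) p' p =
        mat_right L A B F p' (r @ q') \<cdot> mat_left k A K L G (r @ q') p"
      using * by (intro sum_cmp_single[OF inL inR])
        (auto elim!: mat_left_nonzero mat_right_nonzero simp: lattice_def)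
    moreover have "tensor_left (koszul_sign (k * sum_list r')) (total_deg B r') (pobj K q) (pobj L q') (pobj B r') (G q' q) \<cdot>
        tensor_right (total_deg K q) (total_deg A r) (total_deg B r') (pobj A r) (pobj B r') (pobj K q) (F r' r) =
      scale C (koszul_sign (k * l))
        (tensor_right (total_deg L q') (total_deg A r) (total_deg B r') (pobj A r) (pobj B r') (pobj L q') (F r' r) \<cdot>
         tensor_left (koszul_sign (k * sum_list r)) (total_deg A r) (pobj K q) (pobj L q') (pobj A r) (G q' q))"
    \<comment> \<open>The relation \<open>sum_list r' = sum_list r + l\<close> behind the sign is
      available at nonzero entries of \<open>F\<close>; at a zero entry both sides vanish.\<close>
    proof (cases "F r' r = 0")
      case True
      then show ?thesis
        by (simp add: cmp_zero(1)[OF tensor_left_Hom[OF total_hom_entry[OF G]]]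
            cmp_zero(2)[OF tensor_left_Hom[OF total_hom_entry[OF G]]])
    next
      case False
      then have "koszul_sign (k * sum_list r') = (koszul_sign (k * l) * koszul_sign (k * sum_list r) :: 'k)"
        unfolding koszul_sign_add[symmetric] using deg_hom_degree[OF F False] by (simp add: algebra_simps)
      then show ?thesis
        using tensor_left_right[OF total_hom_entry[OF F] total_hom_entry[OF G],
            of r' r "total_deg B r'" "total_deg A r" q' q "total_deg L q'" "total_deg K q"] hom
        by (auto simp: homogeneous_def)
    qed
    ultimately show ?thesis using * by (simp add: mat_left_append mat_right_append)
  qed
qed

lemma mat_left_right_even:
  assumes "F \<in> deg_hom l (total_obj A) (total_obj B)" "G \<in> deg_hom k (total_obj K) (total_obj L)"
    and "homogeneous A B F \<or> homogeneous K L G" "even (k * l)"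
  shows "sum_cmp C (mat_left k B K L G) (mat_right K A B F) =
    sum_cmp C (mat_right L A B F) (mat_left k A K L G)"
  using assms(4)
  by (intro ext) (simp add: mat_left_right[OF assms(1-3)] koszul_sign_def
      scale_one[OF sum_hom_entry[OF deg_hom_sum_hom[OF deg_hom_cmp[OF mat_left_in[OF assms(2)] mat_right_in[OF assms(1)]]]]])

lemma mat_left_right_odd:
  assumes "F \<in> deg_hom l (total_obj A) (total_obj B)" "G \<in> deg_hom k (total_obj K) (total_obj L)"
    and "homogeneous A B F \<or> homogeneous K L G" "odd (k * l)"
  shows "sum_cmp C (mat_left k B K L G) (mat_right K A B F) +
    sum_cmp C (mat_right L A B F) (mat_left k A K L G) = 0"
  using assms(4)
  by (intro ext) (simp add: mat_left_right[OF assms(1-3)] koszul_sign_def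
      scale_minus_one[OF sum_hom_entry[OF deg_hom_sum_hom[OF deg_hom_cmp[OF mat_left_in[OF assms(2)] mat_right_in[OF assms(1)]]]]])

lemma equivalent_tensor_right:
  assumes eq: "equivalent (total_obj A) (total_diff A) (total_obj B) (total_diff B)"
    and hom: "homogeneous_polycomplex C A" "homogeneous_polycomplex C B" "homogeneous_polycomplex C K"
    and K: "total_diff K \<in> deg_hom 1 (total_obj K) (total_obj K)" "sum_cmp C (total_diff K) (total_diff K) = 0"
  shows "equivalent (total_obj (tensor \<mu> C A K)) (total_diff (tensor \<mu> C A K))
    (total_obj (tensor \<mu> C B K)) (total_diff (tensor \<mu> C B K))"
  unfolding total_diff_tensor[OF hom(1,3)] total_diff_tensor[OF hom(2,3)]
proof (rule equivalent_functor[where Ob = total_obj and Ob' = "\<lambda>x. total_obj (tensor \<mu> C x K)"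
      and T = "\<lambda>_. mat_right K"
      and R = "\<lambda>x. mat_left 1 x K K (total_diff K)", OF eq])
  note hK = homogeneous_total_diff[OF hom(3)]
  show "sum_cmp C (mat_left 1 x K K (total_diff K)) (mat_left 1 x K K (total_diff K)) = 0" for x
    \<comment> \<open>The square is the image of the zero matrix in degree \<open>2\<close>, and
      additivity on \<open>0 + 0\<close> shows that this image is zero.\<close>
    using mat_left_add[of 0 2 K K 0 2 x] by (simp add: mat_left_cmp[OF K(1) K(1)] K(2) deg_hom_def)
  show "sum_cmp C (mat_left 1 y K K (total_diff K)) (mat_right K x y F) =
      sum_cmp C (mat_right K x y F) (mat_left 1 x K K (total_diff K))"
    if "F \<in> deg_hom 0 (total_obj x) (total_obj y)" for x y F
    using mat_left_right_even[OF that K(1)] hK by simp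
  show "sum_cmp C (mat_left 1 y K K (total_diff K)) (mat_right K x y F) +
      sum_cmp C (mat_right K x y F) (mat_left 1 x K K (total_diff K)) = 0"
    if "odd k" "F \<in> deg_hom k (total_obj x) (total_obj y)" for x y k F
    using mat_left_right_odd[OF that(2) K(1)] hK that(1) by simp
qed (simp_all add: mat_right_in mat_right_add mat_right_cmp mat_right_id mat_left_in K)

lemma equivalent_tensor_left:
  assumes eq: "equivalent (total_obj K) (total_diff K) (total_obj L) (total_diff L)"
    and hom: "homogeneous_polycomplex C K" "homogeneous_polycomplex C L" "homogeneous_polycomplex C A"
    and A: "total_diff A \<in> deg_hom 1 (total_obj A) (total_obj A)" "sum_cmp C (total_diff A) (total_diff A) = 0"
  shows "equivalent (total_obj (tensor \<mu> C A K)) (total_diff (tensor \<mu> C A K))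
    (total_obj (tensor \<mu> C A L)) (total_diff (tensor \<mu> C A L))"
  \<comment> \<open>The functorial part is now the second summand of the differential, whereas
    \<open>equivalent_functor\<close> expects it first.\<close>
  unfolding total_diff_tensor[OF hom(3,1)] total_diff_tensor[OF hom(3,2)] add.commute[of "mat_right _ _ _ _"]
proof (rule equivalent_functor[where Ob = total_obj and Ob' = "\<lambda>x. total_obj (tensor \<mu> C A x)"
      and T = "\<lambda>k. mat_left k A"
      and R = "\<lambda>x. mat_right x A A (total_diff A)", OF eq])
  note hA = homogeneous_total_diff[OF hom(3)]
  show "sum_cmp C (mat_right x A A (total_diff A)) (mat_right x A A (total_diff A)) = 0" for x
    using mat_right_add[of 0 2 A A 0 x] by (simp add: mat_right_cmp[OF A(1) A(1)] A(2) deg_hom_def)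
  show "sum_cmp C (mat_right y A A (total_diff A)) (mat_left 0 A x y F) =
      sum_cmp C (mat_left 0 A x y F) (mat_right x A A (total_diff A))"
    if "F \<in> deg_hom 0 (total_obj x) (total_obj y)" for x y F
    using mat_left_right_even[OF A(1) that] hA by simp
  show "sum_cmp C (mat_right y A A (total_diff A)) (mat_left k A x y F) +
      sum_cmp C (mat_left k A x y F) (mat_right x A A (total_diff A)) = 0"
    if "odd k" "F \<in> deg_hom k (total_obj x) (total_obj y)" for x y k F
    using mat_left_right_odd[OF A(1) that(2)] hA that(1) by (simp add: add.commute)
qed (simp_all add: mat_left_in mat_left_add mat_left_cmp mat_left_id mat_right_in A)

end

theorem theorem4p1p9:
  fixes \<mu> :: "'g::ab_group_add \<Rightarrow> 'g \<Rightarrow> 'k::{comm_ring, comm_monoid_mult}"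
    and C :: "('k, 'g, 'o, 'm::ab_group_add) gmcat"
    and A1 A2 B1 B2 :: "('g, 'o, 'm) polycomplex"
  assumes "graded_monoidal_category \<mu> C"
    and "symmetric_bicharacter \<mu>"
    and "homogeneous_polycomplex C A1" and "homogeneous_polycomplex C A2"
    and "homogeneous_polycomplex C B1" and "homogeneous_polycomplex C B2"
    and "homotopy_equivalent C (Tot A1) (Tot B1)"
    and "homotopy_equivalent C (Tot A2) (Tot B2)"
  shows "homotopy_equivalent C (Tot (tensor \<mu> C A1 A2)) (Tot (tensor \<mu> C B1 B2))"
proof -
  interpret graded_monoidal_category \<mu> C by fact
  interpret symmetric_graded_monoidal_category \<mu> C
    using assms(2) by unfold_locales (simp add: symmetric_bicharacter_def)
  have e: "equivalent (total_obj A1) (total_diff A1) (total_obj B1) (total_diff B1)"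
    "equivalent (total_obj A2) (total_diff A2) (total_obj B2) (total_diff B2)"
    using assms(7,8) by (simp_all add: Tot_eq_split homotopy_equivalent_split)
  \<comment> \<open>That the differential of the unchanged factor has degree one and square zero is
    part of that factor's own equivalence.\<close>
  have "equivalent (total_obj (tensor \<mu> C A1 A2)) (total_diff (tensor \<mu> C A1 A2))
      (total_obj (tensor \<mu> C B1 A2)) (total_diff (tensor \<mu> C B1 A2))"
    using e assms(3-6) by (intro equivalent_tensor_right) (simp_all add: equivalent_def)
  moreover have "equivalent (total_obj (tensor \<mu> C B1 A2)) (total_diff (tensor \<mu> C B1 A2))
      (total_obj (tensor \<mu> C B1 B2)) (total_diff (tensor \<mu> C B1 B2))"
    using e assms(3-6) by (intro equivalent_tensor_left) (simp_all add: equivalent_def)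
  ultimately show ?thesis
    by (simp add: Tot_eq_split homotopy_equivalent_split) (rule equivalent_trans)
qed

end
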